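(* Let $\varphi,\psi,\mu,\nu$ be non-negative locally finite Borel measures on $\mathbb R^d$ with $\mu\ge\varphi$, $\nu\le\psi$, and suppose the pair $(\mu,\psi)$ satisfies Assumption 1. Let $f$ be any stable constrained density for $(\mu,\nu)$, and let $f_s$ be the site-optimal density for $(\varphi,\psi)$, with $A,R,a$ the associated final application function, rejection function and application radius. Then: (i) $f+R\le1$ $(\mu\otimes\psi)$-a.e.; (ii) for $(\mu\otimes\psi)$-a.e. $(x,\xi)$, if $A(x,\xi)=1$ (in particular if $|x-\xi|<a(x)$) then $f(x,\xi)\le f_s(x,\xi)$; (iii) for $\mu$-a.e. $x$, $g_x^{f}(t;\nu)\le g_x^{f_s}(t;\psi)$ for all $t\in[0,\infty]$; (iv) for $\psi$-a.e. $\xi$, $h^\xi_{f}(t;\mu)\ge h^\xi_{f_s}(t;\varphi)$ for all $t\in[0,\infty]$.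
   Context: $\mu\ge\varphi$ means $\mu(B)\ge\varphi(B)$ for all Borel $B$. $\overline B(x,r)$ is the closed ball (empty if $r<0$), $\partial$ its boundary. Assumption 1 for a pair $(\varphi,\psi)$: for $\varphi$-a.e. $x$ and every $r>0$ there is $s\in\partial\overline B(x,r)$ with $\psi(\partial\overline B(x,r)\setminus\{s\})=0$; and for $\psi$-a.e. $\xi$ and every $r>0$ there is $s\in\partial\overline B(\xi,r)$ with $\varphi(\partial\overline B(\xi,r)\setminus\{s\})=0$. Densities and stability for $(\varphi,\psi)$: a non-negative measurable $f$ is a constrained density if $\int f(x,\xi)\psi(d\xi)\le1$ for all $x$, $\int f(x,\xi)\varphi(dx)\le1$ for all $\xi$, and $f\le 1$. A site $x_0$ is exhausted if $\int f(x_0,\xi)\psi(d\xi)=1$, else unexhausted; a center $\xi_0$ is sated if $\int f(x,\xi_0)\varphi(dx)=1$, else unsated. $x_0$ desires $\xi_0$ if $f(x_0,\xi_0)<1$ and either $x_0$ is unexhausted or some $\xi_1$ has $|x_0-\xi_1|>|x_0-\xi_0|$ and $f(x_0,\xi_1)>0$. $\xi_0$ desires $x_0$ if $f(x_0,\xi_0)<1$ and either $\xi_0$ is unsated or some $x_1$ has $|x_1-\xi_0|>|x_0-\xi_0|$ and $f(x_1,\xi_0)>0$. $f$ is stable if no pair desires each other. For $t\in[0,\infty]$: $g_x^f(t;\psi)=\int f(x,\xi)1_{|x-\xi|\le t}\psi(d\xi)$, $h^\xi_f(t;\varphi)=\int f(x,\xi)1_{|x-\xi|\le t}\varphi(dx)$.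 Site-optimal density for $(\varphi,\psi)$: $R_0\equiv0$; at stage $n\ge1$: (i) $a_n(x_0)=\sup\{a:\int_{\overline B(x_0,a)}(1-R_{n-1}(x_0,\xi))\psi(d\xi)\le1\}$; $A_n(x_0,\xi)=1$ if $|x_0-\xi|<a_n(x_0)$, $=cR_{n-1}(x_0,\xi)+1-c$ if $|x_0-\xi|=a_n(x_0)$, $=0$ if $|x_0-\xi|>a_n(x_0)$, with $c\in[0,1]$ chosen so that $\int(A_n-R_{n-1})(x_0,\xi)\psi(d\xi)=1$ if $a_n(x_0)<\infty$, and $c=1$ if $a_n(x_0)=\infty$ or $\psi(\partial\overline B(x_0,a_n(x_0)))=0$. (ii) $r_n(\xi_0)=\sup\{r:\int_{\overline B(\xi_0,r)}A_n(x,\xi_0)\varphi(dx)\le1\}$; $R_n(x,\xi_0)=0$ if $|x-\xi_0|<r_n(\xi_0)$, $=c'A_n(x,\xi_0)$ if $|x-\xi_0|=r_n(\xi_0)$, $=A_n(x,\xi_0)$ if $|x-\xi_0|>r_n(\xi_0)$, with $c'\in[0,1]$ chosen so that $\int(A_n-R_n)(x,\xi_0)\varphi(dx)=1$ if $r_n(\xi_0)<\infty$, and $c'=0$ if $r_n(\xi_0)=\infty$ or $\varphi(\partial\overline B(\xi_0,r_n(\xi_0)))=0$. $A_n,R_n,a_n$ are non-decreasing in $n$; $A=\lim A_n$, $R=\lim R_n$, $a=\lim a_n$, $f_s=A-R$. *)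

theory Defs
  imports "HOL-Analysis.Analysis" "HOL-Probability.Probability"
begin

definition borel_meas :: "'a::euclidean_space measure \<Rightarrow> bool" where
  "borel_meas M \<longleftrightarrow> sets M = sets borel"

definition locally_finite :: "'a::euclidean_space measure \<Rightarrow> bool" where
  "locally_finite M \<longleftrightarrow> (\<forall>K. compact K \<longrightarrow> emeasure M K < \<infinity>)"

definition meas_ge :: "'a::euclidean_space measure \<Rightarrow> 'a measure \<Rightarrow> bool" where
  "meas_ge M N \<longleftrightarrow> (\<forall>B \<in> sets borel. emeasure N B \<le> emeasure M B)"

definition assumption1 :: "'a::euclidean_space measure \<Rightarrow> 'a measure \<Rightarrow> bool" where
  "assumption1 \<phi> \<psi> \<longleftrightarrow>
     (AE x in \<phi>. \<forall>r>0. \<exists>s\<in>sphere x r. emeasure \<psi> (sphere x r - {s}) = 0) \<and>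
     (AE \<xi> in \<psi>. \<forall>r>0. \<exists>s\<in>sphere \<xi> r. emeasure \<phi> (sphere \<xi> r - {s}) = 0)"

definition site_mass :: "('a \<Rightarrow> 'a \<Rightarrow> real) \<Rightarrow> 'a measure \<Rightarrow> 'a \<Rightarrow> ennreal" where
  "site_mass f \<psi> x = (\<integral>\<^sup>+ \<xi>. ennreal (f x \<xi>) \<partial>\<psi>)"

definition center_mass :: "('a \<Rightarrow> 'a \<Rightarrow> real) \<Rightarrow> 'a measure \<Rightarrow> 'a \<Rightarrow> ennreal" where
  "center_mass f \<phi> \<xi> = (\<integral>\<^sup>+ x. ennreal (f x \<xi>) \<partial>\<phi>)"

definition constrained_density ::
  "'a::euclidean_space measure \<Rightarrow> 'a measure \<Rightarrow> ('a \<Rightarrow> 'a \<Rightarrow> real) \<Rightarrow> bool" where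
  "constrained_density \<phi> \<psi> f \<longleftrightarrow>
     (\<lambda>(x, \<xi>). f x \<xi>) \<in> borel_measurable borel \<and>
     (\<forall>x \<xi>. 0 \<le> f x \<xi> \<and> f x \<xi> \<le> 1) \<and>
     (\<forall>x. site_mass f \<psi> x \<le> 1) \<and>
     (\<forall>\<xi>. center_mass f \<phi> \<xi> \<le> 1)"

definition site_desires ::
  "'a::euclidean_space measure \<Rightarrow> ('a \<Rightarrow> 'a \<Rightarrow> real) \<Rightarrow> 'a \<Rightarrow> 'a \<Rightarrow> bool" where
  "site_desires \<psi> f x0 \<xi>0 \<longleftrightarrow> f x0 \<xi>0 < 1 \<and>
     (site_mass f \<psi> x0 \<noteq> 1 \<or> (\<exists>\<xi>1. dist x0 \<xi>1 > dist x0 \<xi>0 \<and> f x0 \<xi>1 > 0))"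

definition center_desires ::
  "'a::euclidean_space measure \<Rightarrow> ('a \<Rightarrow> 'a \<Rightarrow> real) \<Rightarrow> 'a \<Rightarrow> 'a \<Rightarrow> bool" where
  "center_desires \<phi> f \<xi>0 x0 \<longleftrightarrow> f x0 \<xi>0 < 1 \<and>
     (center_mass f \<phi> \<xi>0 \<noteq> 1 \<or> (\<exists>x1. dist x1 \<xi>0 > dist x0 \<xi>0 \<and> f x1 \<xi>0 > 0))"

definition stable ::
  "'a::euclidean_space measure \<Rightarrow> 'a measure \<Rightarrow> ('a \<Rightarrow> 'a \<Rightarrow> real) \<Rightarrow> bool" where
  "stable \<phi> \<psi> f \<longleftrightarrow> \<not> (\<exists>x0 \<xi>0. site_desires \<psi> f x0 \<xi>0 \<and> center_desires \<phi> f \<xi>0 x0)"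

definition g_fun :: "('a::euclidean_space \<Rightarrow> 'a \<Rightarrow> real) \<Rightarrow> 'a \<Rightarrow> ereal \<Rightarrow> 'a measure \<Rightarrow> ennreal" where
  "g_fun f x t \<psi> = (\<integral>\<^sup>+ \<xi>. ennreal (f x \<xi>) * indicator {\<xi>. ereal (dist x \<xi>) \<le> t} \<xi> \<partial>\<psi>)"

definition h_fun :: "('a::euclidean_space \<Rightarrow> 'a \<Rightarrow> real) \<Rightarrow> 'a \<Rightarrow> ereal \<Rightarrow> 'a measure \<Rightarrow> ennreal" where
  "h_fun f \<xi> t \<phi> = (\<integral>\<^sup>+ x. ennreal (f x \<xi>) * indicator {x. ereal (dist x \<xi>) \<le> t} x \<partial>\<phi>)"

text \<open>The site-optimal construction.  Stage n+1 of the paper is index Suc n here;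
  Rn 0 = R_0 = 0.  Radii a_n, r_n are extended reals (may be infinite).
  The constants c, c' are allowed to depend on the stage and on the point.
  The predicate holds for (A, R, a) iff they arise from some admissible run of the construction.\<close>
definition site_optimal ::
  "'a::euclidean_space measure \<Rightarrow> 'a measure \<Rightarrow> ('a \<Rightarrow> 'a \<Rightarrow> real) \<Rightarrow> ('a \<Rightarrow> 'a \<Rightarrow> real)
     \<Rightarrow> ('a \<Rightarrow> ereal) \<Rightarrow> bool" where
  "site_optimal \<phi> \<psi> A R a \<longleftrightarrow>
    (\<exists>(An :: nat \<Rightarrow> 'a \<Rightarrow> 'a \<Rightarrow> real) (Rn :: nat \<Rightarrow> 'a \<Rightarrow> 'a \<Rightarrow> real)
       (an :: nat \<Rightarrow> 'a \<Rightarrow> ereal) (rn :: nat \<Rightarrow> 'a \<Rightarrow> ereal)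
       (c :: nat \<Rightarrow> 'a \<Rightarrow> real) (c' :: nat \<Rightarrow> 'a \<Rightarrow> real).
      (\<forall>x \<xi>. Rn 0 x \<xi> = 0) \<and>
      (\<forall>n x0.
         an (Suc n) x0 = Sup (ereal ` {s::real.
            (\<integral>\<^sup>+ \<xi>. ennreal (1 - Rn n x0 \<xi>) * indicator (cball x0 s) \<xi> \<partial>\<psi>) \<le> 1}) \<and>
         0 \<le> c (Suc n) x0 \<and> c (Suc n) x0 \<le> 1 \<and>
         (\<forall>\<xi>. An (Suc n) x0 \<xi> =
            (if ereal (dist x0 \<xi>) < an (Suc n) x0 then 1
             else if ereal (dist x0 \<xi>) = an (Suc n) x0
               then c (Suc n) x0 * Rn n x0 \<xi> + 1 - c (Suc n) x0
             else 0)) \<and>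
         (an (Suc n) x0 < \<infinity> \<longrightarrow>
            (\<integral>\<^sup>+ \<xi>. ennreal (An (Suc n) x0 \<xi> - Rn n x0 \<xi>) \<partial>\<psi>) = 1) \<and>
         ((an (Suc n) x0 = \<infinity> \<or>
             emeasure \<psi> (sphere x0 (real_of_ereal (an (Suc n) x0))) = 0)
            \<longrightarrow> c (Suc n) x0 = 1)) \<and>
      (\<forall>n \<xi>0.
         rn (Suc n) \<xi>0 = Sup (ereal ` {s::real.
            (\<integral>\<^sup>+ x. ennreal (An (Suc n) x \<xi>0) * indicator (cball \<xi>0 s) x \<partial>\<phi>) \<le> 1}) \<and>
         0 \<le> c' (Suc n) \<xi>0 \<and> c' (Suc n) \<xi>0 \<le> 1 \<and>
         (\<forall>x. Rn (Suc n) x \<xi>0 =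
            (if ereal (dist x \<xi>0) < rn (Suc n) \<xi>0 then 0
             else if ereal (dist x \<xi>0) = rn (Suc n) \<xi>0
               then c' (Suc n) \<xi>0 * An (Suc n) x \<xi>0
             else An (Suc n) x \<xi>0)) \<and>
         (rn (Suc n) \<xi>0 < \<infinity> \<longrightarrow>
            (\<integral>\<^sup>+ x. ennreal (An (Suc n) x \<xi>0 - Rn (Suc n) x \<xi>0) \<partial>\<phi>) = 1) \<and>
         ((rn (Suc n) \<xi>0 = \<infinity> \<or>
             emeasure \<phi> (sphere \<xi>0 (real_of_ereal (rn (Suc n) \<xi>0))) = 0)
            \<longrightarrow> c' (Suc n) \<xi>0 = 0)) \<and>
      (\<forall>x \<xi>. (\<lambda>n. An n x \<xi>) \<longlonglongrightarrow> A x \<xi>) \<and>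
      (\<forall>x \<xi>. (\<lambda>n. Rn n x \<xi>) \<longlonglongrightarrow> R x \<xi>) \<and>
      (\<forall>x. (\<lambda>n. an n x) \<longlonglongrightarrow> a x))"

end

theory Submission
  imports Defs
begin

text \<open>
  Induct on the stage \<open>n\<close> to show \<open>f + R\<^sub>n \<le> 1\<close> almost everywhere. If a site \<open>x\<close> has
  \<open>f < A\<^sub>n - R\<^sub>n\<^sub>-\<^sub>1\<close> at \<open>\<xi>\<close> but does not desire \<open>\<xi>\<close>, then \<open>f(x, \<cdot>)\<close> puts its full mass 1 within
  distance \<open>|x - \<xi>|\<close>, where it is dominated by \<open>1 - R\<^sub>n\<^sub>-\<^sub>1\<close>, and hence by \<open>A\<^sub>n - R\<^sub>n\<^sub>-\<^sub>1\<close>, whose mass is at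
  most 1; so the two agree almost everywhere. Thus \<open>f < A\<^sub>n - R\<^sub>n\<^sub>-\<^sub>1\<close> forces \<open>x\<close> to desire \<open>\<xi>\<close> and, by
  stability, \<open>\<xi>\<close> not to desire \<open>x\<close>. A center \<open>\<xi>\<close> that rejects at stage \<open>n\<close> retains mass exactly
  1 under \<open>\<phi> \<le> \<mu>\<close>, so a set of sites with \<open>f + R\<^sub>n > 1\<close> of positive measure would leave \<open>f\<close> below
  \<open>A\<^sub>n - R\<^sub>n\<close> at some closer site, which \<open>\<xi>\<close> would then desire. Spheres carrying at most one
  atom take care of the ties at the boundary of the balls.

  Comparison of the limit densities uses the same dichotomy: if \<open>a(x) < \<infinity>\<close>, dominated convergence
  makes \<open>x\<close> exhausted under \<open>A - R\<close>; and if \<open>f < A - R\<close> at \<open>(x, \<xi>)\<close>, then \<open>\<xi>\<close> is sated under \<open>f\<close> by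
  sites no farther than \<open>x\<close>.
\<close>

section \<open>Cutting a density at mass one\<close>

text \<open>
  Both stages of the construction are instances: a site cuts \<open>w = 1 - R\<^sub>n\<^sub>-\<^sub>1\<close> with \<open>\<theta> = 1 - c\<close>,
  a center cuts \<open>w = A\<^sub>n\<close> with \<open>\<theta> = 1 - c'\<close>. The parameter \<open>\<theta>0\<close> of \<open>is_cut\<close> is the
  value prescribed for \<open>\<theta>\<close> when the bounding sphere is null.
\<close>

definition cut_fun :: "'a::metric_space \<Rightarrow> ereal \<Rightarrow> real \<Rightarrow> ('a \<Rightarrow> real) \<Rightarrow> 'a \<Rightarrow> real" where
  "cut_fun x \<rho> \<theta> w y =
     (if ereal (dist x y) < \<rho> then w y else if ereal (dist x y) = \<rho> then \<theta> * w y else 0)"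

definition cut_radius :: "'a::metric_space measure \<Rightarrow> 'a \<Rightarrow> ('a \<Rightarrow> real) \<Rightarrow> ereal" where
  "cut_radius M x w =
     Sup (ereal ` {s. (\<integral>\<^sup>+ y. ennreal (w y) * indicator (cball x s) y \<partial>M) \<le> 1})"

definition is_cut ::
  "'a::metric_space measure \<Rightarrow> 'a \<Rightarrow> ('a \<Rightarrow> real) \<Rightarrow> ereal \<Rightarrow> real \<Rightarrow> real \<Rightarrow> bool" where
  "is_cut M x w \<rho> \<theta> \<theta>0 \<longleftrightarrow>
     \<rho> = cut_radius M x w \<and> 0 \<le> \<theta> \<and> \<theta> \<le> 1 \<and>
     (\<rho> < \<infinity> \<longrightarrow> (\<integral>\<^sup>+ y. ennreal (cut_fun x \<rho> \<theta> w y) \<partial>M) = 1) \<and>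
     (\<rho> < \<infinity> \<longrightarrow> emeasure M (sphere x (real_of_ereal \<rho>)) = 0 \<longrightarrow> \<theta> = \<theta>0)"

text \<open>The mass of a cut is \<open>ball_mass + \<theta> * sphere_mass\<close>. When it equals
  1, these two numbers determine \<open>\<theta>\<close>, provided the second is nonzero and
  finite.\<close>

definition ball_mass :: "'a::metric_space measure \<Rightarrow> 'a \<Rightarrow> ereal \<Rightarrow> ('a \<Rightarrow> real) \<Rightarrow> ennreal" where
  "ball_mass M x \<rho> w = (\<integral>\<^sup>+ y. ennreal (w y) * indicator {y. ereal (dist x y) < \<rho>} y \<partial>M)"

definition sphere_mass :: "'a::metric_space measure \<Rightarrow> 'a \<Rightarrow> ereal \<Rightarrow> ('a \<Rightarrow> real) \<Rightarrow> ennreal" where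
  "sphere_mass M x \<rho> w = (\<integral>\<^sup>+ y. ennreal (w y) * indicator {y. ereal (dist x y) = \<rho>} y \<partial>M)"

text \<open>The pointwise condition in each half of \<open>assumption1\<close>, stated at one point
  so that the same arguments serve sites and centers.\<close>

definition atomic_spheres :: "'a::metric_space measure \<Rightarrow> 'a \<Rightarrow> bool" where
  "atomic_spheres N x \<longleftrightarrow> (\<forall>r>0. \<exists>s\<in>sphere x r. emeasure N (sphere x r - {s}) = 0)"

locale lf_borel =
  fixes M :: "'a::euclidean_space measure"
  assumes meas: "borel_meas M" and lf: "locally_finite M"
begin

lemma sets_eq [simp, measurable_cong]: "sets M = sets borel"
  using meas by (simp add: borel_meas_def)

lemma space_eq [simp]: "space M = UNIV"
  using sets_eq_imp_space_eq[OF sets_eq] by simp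

lemma emeasure_cball_finite: "emeasure M (cball x r) < \<infinity>"
  using lf by (simp add: locally_finite_def)

sublocale sigma_finite_measure M
proof
  show "\<exists>A. countable A \<and> A \<subseteq> sets M \<and> \<Union> A = space M \<and> (\<forall>a\<in>A. emeasure M a \<noteq> \<infinity>)"
  proof (intro exI[of _ "range (\<lambda>n::nat. cball (0::'a) (real n))"] conjI ballI)
    show "\<Union> (range (\<lambda>n::nat. cball (0::'a) (real n))) = space M"
      by (auto simp: real_arch_simple)
  qed (use emeasure_cball_finite[of 0] in \<open>auto simp: less_top[symmetric]\<close>)
qed

end

section \<open>Elementary properties of cuts\<close>

lemma cut_fun_bounds:
  assumes "0 \<le> \<theta>" "\<theta> \<le> 1" "0 \<le> w y"
  shows "0 \<le> cut_fun x \<rho> \<theta> w y" "cut_fun x \<rho> \<theta> w y \<le> w y"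
  using assms by (auto simp: cut_fun_def mult_left_le_one_le)

lemma cut_radius_cong_AE:
  assumes "AE y in M. w y = w' y"
  shows "cut_radius M x w = cut_radius M x w'"
proof -
  have "(\<integral>\<^sup>+ y. ennreal (w y) * indicator (cball x s) y \<partial>M) =
        (\<integral>\<^sup>+ y. ennreal (w' y) * indicator (cball x s) y \<partial>M)" for s
    by (rule nn_integral_cong_AE) (use assms in eventually_elim, simp)
  then show ?thesis by (simp add: cut_radius_def)
qed

text \<open>\<open>is_cut\<close> depends on \<open>w\<close> only through integrals against
  \<open>M\<close>, so \<open>w\<close> may be replaced by a Borel representative.\<close>

lemma is_cut_cong_AE:
  assumes "AE y in M. w y = w' y" "is_cut M x w \<rho> \<theta> \<theta>0"
  shows "is_cut M x w' \<rho> \<theta> \<theta>0"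
proof -
  have eq: "(\<integral>\<^sup>+ y. ennreal (cut_fun x \<rho> \<theta> w y) \<partial>M) = (\<integral>\<^sup>+ y. ennreal (cut_fun x \<rho> \<theta> w' y) \<partial>M)"
    by (rule nn_integral_cong_AE) (use assms(1) in eventually_elim, simp add: cut_fun_def)
  from assms(2) show ?thesis
    unfolding is_cut_def eq cut_radius_cong_AE[OF assms(1)] .
qed

lemma cut_radius_mono:
  assumes "AE y in M. w1 y \<le> w2 y"
  shows "cut_radius M x w2 \<le> cut_radius M x w1"
proof -
  have "(\<integral>\<^sup>+ y. ennreal (w1 y) * indicator (cball x s) y \<partial>M) \<le>
        (\<integral>\<^sup>+ y. ennreal (w2 y) * indicator (cball x s) y \<partial>M)" for s
    by (rule nn_integral_mono_AE)
      (use assms in eventually_elim, auto simp: indicator_def intro: ennreal_leI)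
  then show ?thesis
    unfolding cut_radius_def by (intro Sup_subset_mono image_mono) (auto intro: order_trans)
qed

lemma cut_radius_not_MInf: "cut_radius M x w \<noteq> - \<infinity>"
proof -
  \<comment> \<open>The closed ball of radius -1 is empty, so -1 is an admissible radius for every
    \<open>w\<close>.\<close>
  have "ereal (-1) \<le> cut_radius M x w"
    unfolding cut_radius_def by (intro Sup_upper imageI) simp
  then show ?thesis by auto
qed

lemma sphere_eq_ereal:
  assumes "\<rho> < \<infinity>" "\<rho> \<noteq> - \<infinity>"
  shows "{y. ereal (dist x y) = \<rho>} = sphere x (real_of_ereal \<rho>)"
  using assms by (cases \<rho>) auto

lemma atomic_spheresE:
  assumes "atomic_spheres N x" "sets N = sets borel"
  obtains s where "AE y in N. ereal (dist x y) = \<rho> \<longrightarrow> y = (s :: 'a :: euclidean_space)"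
proof (cases "\<rho> > 0 \<and> \<rho> < \<infinity>")
  case True
  then obtain r where r: "\<rho> = ereal r" "r > 0"
    by (cases \<rho>) auto
  then obtain s where s: "emeasure N (sphere x r - {s}) = 0"
    using assms(1) by (auto simp: atomic_spheres_def)
  have "sphere x r - {s} \<in> null_sets N"
    using s by (auto simp: null_sets_def assms(2))
  from AE_not_in[OF this] have "AE y in N. ereal (dist x y) = \<rho> \<longrightarrow> y = s"
    by eventually_elim (use r in auto)
  then show ?thesis by (rule that)
next
  case False
  \<comment> \<open>At radius 0 the sphere is the point \<open>x\<close> itself; at a negative or
    infinite radius it is empty.\<close>
  have "ereal (dist x y) = \<rho> \<longrightarrow> y = x" for y
    using False by auto
  then show ?thesis by (intro that[of x]) simp
qed

section \<open>Masses of cuts and comparison of their fractions\<close>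

context lf_borel
begin

lemma nn_integral_cut_fun:
  assumes [measurable]: "w \<in> borel_measurable borel" and "\<And>y. 0 \<le> w y" "0 \<le> \<theta>"
  shows "(\<integral>\<^sup>+ y. ennreal (cut_fun x \<rho> \<theta> w y) \<partial>M) =
           ball_mass M x \<rho> w + ennreal \<theta> * sphere_mass M x \<rho> w"
proof -
  have "(\<integral>\<^sup>+ y. ennreal (cut_fun x \<rho> \<theta> w y) \<partial>M) =
      (\<integral>\<^sup>+ y. ennreal (w y) * indicator {y. ereal (dist x y) < \<rho>} y +
         ennreal \<theta> * (ennreal (w y) * indicator {y. ereal (dist x y) = \<rho>} y) \<partial>M)"
    using assms by (intro nn_integral_cong) (auto simp: cut_fun_def indicator_def ennreal_mult)
  also have "\<dots> = ball_mass M x \<rho> w + ennreal \<theta> * sphere_mass M x \<rho> w"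
    unfolding ball_mass_def sphere_mass_def
    by (subst nn_integral_add, measurable) (subst nn_integral_cmult, measurable)
  finally show ?thesis .
qed

lemma is_cut_masses:
  assumes "w \<in> borel_measurable borel" "\<And>y. 0 \<le> w y" "is_cut M x w \<rho> \<theta> \<theta>0" "\<rho> < \<infinity>"
  shows "ball_mass M x \<rho> w + ennreal \<theta> * sphere_mass M x \<rho> w = 1"
proof -
  have "0 \<le> \<theta>" "(\<integral>\<^sup>+ y. ennreal (cut_fun x \<rho> \<theta> w y) \<partial>M) = 1"
    using assms(3,4) unfolding is_cut_def by metis+
  with nn_integral_cut_fun[OF assms(1,2)] show ?thesis by simp
qed

lemma sphere_mass_finite:
  assumes "\<And>y. w y \<le> 1" "\<rho> < \<infinity>"
  shows "sphere_mass M x \<rho> w < \<infinity>"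
proof -
  have "sphere_mass M x \<rho> w \<le> (\<integral>\<^sup>+ y. indicator (cball x (real_of_ereal \<rho>)) y \<partial>M)"
    unfolding sphere_mass_def
  proof (rule nn_integral_mono)
    fix y
    show "ennreal (w y) * indicator {y. ereal (dist x y) = \<rho>} y \<le> indicator (cball x (real_of_ereal \<rho>)) y"
      using assms(1)[of y] by (auto simp: indicator_def)
  qed
  also have "\<dots> < \<infinity>"
    using emeasure_cball_finite by simp
  finally show ?thesis .
qed

text \<open>For a finite radius the mass is 1 by definition. For an infinite one the cut is
  \<open>w\<close> itself, every ball carries mass at most 1, and monotone convergence along balls
  of integer radius gives the bound.\<close>

lemma nn_integral_cut_le_1_borel:
  assumes w [measurable]: "w \<in> borel_measurable borel"
    and "is_cut M x w \<rho> \<theta> \<theta>0"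
  shows "(\<integral>\<^sup>+ y. ennreal (cut_fun x \<rho> \<theta> w y) \<partial>M) \<le> 1"
proof (cases "\<rho> < \<infinity>")
  case True
  with assms(2) show ?thesis
    unfolding is_cut_def by (metis order.refl)
next
  case False
  then have \<rho>: "\<rho> = \<infinity>" by simp
  have "(\<integral>\<^sup>+ y. ennreal (cut_fun x \<rho> \<theta> w y) \<partial>M) = (\<integral>\<^sup>+ y. ennreal (w y) \<partial>M)"
    by (simp add: cut_fun_def \<rho>)
  also have "\<dots> = (\<integral>\<^sup>+ y. (SUP n::nat. ennreal (w y) * indicator (cball x (real n)) y) \<partial>M)"
  proof (rule nn_integral_cong)
    fix y
    obtain n where n: "dist x y \<le> real n" using real_arch_simple by blast
    have "(SUP n::nat. ennreal (w y) * indicator (cball x (real n)) y) = ennreal (w y)"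
    proof (rule antisym)
      show "(SUP n::nat. ennreal (w y) * indicator (cball x (real n)) y) \<le> ennreal (w y)"
        by (rule SUP_least) (auto simp: indicator_def)
      show "ennreal (w y) \<le> (SUP n::nat. ennreal (w y) * indicator (cball x (real n)) y)"
        using n by (intro SUP_upper2[of n]) auto
    qed
    then show "ennreal (w y) = (SUP n::nat. ennreal (w y) * indicator (cball x (real n)) y)" ..
  qed
  also have "\<dots> = (SUP n::nat. \<integral>\<^sup>+ y. ennreal (w y) * indicator (cball x (real n)) y \<partial>M)"
    by (rule nn_integral_monotone_convergence_SUP)
      (auto simp: incseq_def le_fun_def indicator_def)
  also have "\<dots> \<le> 1"
  proof (rule SUP_least)
    fix n :: nat
    have "ereal (real n) < cut_radius M x w"
      using assms(2) \<rho> by (auto simp: is_cut_def)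
    then obtain s where s: "real n < s" "(\<integral>\<^sup>+ y. ennreal (w y) * indicator (cball x s) y \<partial>M) \<le> 1"
      by (auto simp: cut_radius_def less_Sup_iff)
    have "(\<integral>\<^sup>+ y. ennreal (w y) * indicator (cball x (real n)) y \<partial>M) \<le>
          (\<integral>\<^sup>+ y. ennreal (w y) * indicator (cball x s) y \<partial>M)"
      using s(1) by (intro nn_integral_mono) (auto simp: indicator_def)
    with s(2) show "(\<integral>\<^sup>+ y. ennreal (w y) * indicator (cball x (real n)) y \<partial>M) \<le> 1"
      by simp
  qed
  finally show ?thesis .
qed

text \<open>With equal radii, the smaller function has no more mass in the open ball and on the
  sphere, so it needs at least as large a fraction of its sphere mass to reach 1. This fails only if
  it has no sphere mass. The lemma settles the ties in the monotonicity of the stages.\<close>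

lemma cut_fraction_antimono_borel:
  assumes [measurable]: "w1 \<in> borel_measurable borel" "w2 \<in> borel_measurable borel"
    and b: "\<And>y. 0 \<le> w1 y" "\<And>y. w1 y \<le> 1" "\<And>y. 0 \<le> w2 y" "\<And>y. w2 y \<le> 1"
    and le: "AE y in M. w1 y \<le> w2 y"
    and c1: "is_cut M x w1 \<rho> \<theta>1 \<theta>0" and c2: "is_cut M x w2 \<rho> \<theta>2 \<theta>0'" and fin: "\<rho> < \<infinity>"
  shows "\<theta>2 \<le> \<theta>1 \<or> (AE y in M. ereal (dist x y) = \<rho> \<longrightarrow> w1 y = 0)"
proof (cases "sphere_mass M x \<rho> w1 = 0")
  case True
  then have "AE y in M. ennreal (w1 y) * indicator {y. ereal (dist x y) = \<rho>} y = 0"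
    unfolding sphere_mass_def by (subst (asm) nn_integral_0_iff_AE) auto
  then have "AE y in M. ereal (dist x y) = \<rho> \<longrightarrow> w1 y = 0"
    by eventually_elim (use b in \<open>auto simp: indicator_def ennreal_eq_0_iff intro: antisym\<close>)
  then show ?thesis ..
next
  case False
  have th: "0 \<le> \<theta>1" "0 \<le> \<theta>2" using c1 c2 by (auto simp: is_cut_def)
  have S1: "sphere_mass M x \<rho> w1 < \<infinity>" and S2: "sphere_mass M x \<rho> w2 < \<infinity>"
    using b(2,4) fin sphere_mass_finite by blast+
  have e1: "ball_mass M x \<rho> w1 + ennreal \<theta>1 * sphere_mass M x \<rho> w1 = 1"
    using c1 fin b by (intro is_cut_masses) auto
  have e2: "ball_mass M x \<rho> w2 + ennreal \<theta>2 * sphere_mass M x \<rho> w2 = 1"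
    using c2 fin b by (intro is_cut_masses) auto
  have B12: "ball_mass M x \<rho> w1 \<le> ball_mass M x \<rho> w2"
    unfolding ball_mass_def by (rule nn_integral_mono_AE)
      (use le in eventually_elim, auto simp: indicator_def intro: ennreal_leI)
  have S12: "sphere_mass M x \<rho> w1 \<le> sphere_mass M x \<rho> w2"
    unfolding sphere_mass_def by (rule nn_integral_mono_AE)
      (use le in eventually_elim, auto simp: indicator_def intro: ennreal_leI)
  have "\<theta>2 \<le> \<theta>1"
  proof (rule ccontr)
    assume "\<not> \<theta>2 \<le> \<theta>1"
    then have "ennreal \<theta>1 < ennreal \<theta>2" using th by (simp add: ennreal_less_iff)
    then have "ennreal \<theta>1 * sphere_mass M x \<rho> w1 < ennreal \<theta>2 * sphere_mass M x \<rho> w1"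
      using False S1 by (subst (1 2) mult.commute, intro ennreal_mult_strict_left_mono)
        (auto simp: zero_less_iff_neq_zero)
    also have "\<dots> \<le> ennreal \<theta>2 * sphere_mass M x \<rho> w2"
      using S12 by (intro mult_left_mono) auto
    finally have lt: "ennreal \<theta>1 * sphere_mass M x \<rho> w1 < ennreal \<theta>2 * sphere_mass M x \<rho> w2" .
    \<comment> \<open>Finiteness is needed for the strict inequality to survive adding the ball
      mass.\<close>
    have "ball_mass M x \<rho> w1 < \<infinity>"
      using e1 by (metis ennreal_add_eq_top ennreal_one_neq_top infinity_ennreal_def top.not_eq_extremum)
    then have "ball_mass M x \<rho> w1 + ennreal \<theta>1 * sphere_mass M x \<rho> w1 <
               ball_mass M x \<rho> w1 + ennreal \<theta>2 * sphere_mass M x \<rho> w2"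
      using lt by simp
    also have "\<dots> \<le> ball_mass M x \<rho> w2 + ennreal \<theta>2 * sphere_mass M x \<rho> w2"
      using B12 by (intro add_right_mono) auto
    finally show False using e1 e2 by simp
  qed
  then show ?thesis ..
qed

section \<open>Measurable dependence of radii and masses on the point\<close>

lemma borel_measurable_masses:
  assumes [measurable]: "w \<in> borel_measurable (borel \<Otimes>\<^sub>M borel)" "\<rho> \<in> borel_measurable borel"
  shows "(\<lambda>x. ball_mass M x (\<rho> x) (\<lambda>y. w (x, y))) \<in> borel_measurable borel"
    and "(\<lambda>x. sphere_mass M x (\<rho> x) (\<lambda>y. w (x, y))) \<in> borel_measurable borel"
  unfolding ball_mass_def sphere_mass_def by measurable

text \<open>The mass in a closed ball is monotone in the radius, so rational radii give the same
  supremum, now over a countable set. Inadmissible radii contribute \<open>- \<infinity>\<close>,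
  which does not affect it.\<close>

lemma borel_measurable_cut_radius:
  assumes [measurable]: "w \<in> borel_measurable (borel \<Otimes>\<^sub>M borel)"
  shows "(\<lambda>x. cut_radius M x (\<lambda>y. w (x, y))) \<in> borel_measurable borel"
proof -
  define F where "F x s = (\<integral>\<^sup>+ y. ennreal (w (x, y)) * indicator (cball x s) y \<partial>M)" for x s
  have F_mono: "F x s \<le> F x t" if "s \<le> t" for x s t
    unfolding F_def using that by (intro nn_integral_mono) (auto simp: indicator_def)
  have [measurable]: "(\<lambda>x. F x s) \<in> borel_measurable borel" for s
    unfolding F_def cball_def by measurable
  have "cut_radius M x (\<lambda>y. w (x, y)) =
        (SUP q\<in>\<rat>. if F x q \<le> 1 then ereal q else - \<infinity>)" for x
  proof (rule antisym)
    show "(SUP q\<in>\<rat>. if F x q \<le> 1 then ereal q else - \<infinity>) \<le> cut_radius M x (\<lambda>y. w (x, y))"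
      by (rule SUP_least) (auto simp: cut_radius_def F_def intro!: Sup_upper)
    show "cut_radius M x (\<lambda>y. w (x, y)) \<le> (SUP q\<in>\<rat>. if F x q \<le> 1 then ereal q else - \<infinity>)"
    proof (rule dense_le)
      fix t assume "t < cut_radius M x (\<lambda>y. w (x, y))"
      then obtain s where s: "t < ereal s" "F x s \<le> 1"
        by (auto simp: cut_radius_def less_Sup_iff F_def)
      \<comment> \<open>Since \<open>t\<close> may be \<open>- \<infinity>\<close>, a real
        \<open>t'\<close> is inserted below \<open>s\<close> before a rational is chosen.\<close>
      obtain t' where t': "t \<le> ereal t'" "t' < s"
      proof (cases t)
        case (real r) then show ?thesis using s by (intro that[of r]) auto
      next
        case PInf then show ?thesis using s by auto
      next
        case MInf then show ?thesis by (intro that[of "s - 1"]) auto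
      qed
      obtain q where q: "q \<in> \<rat>" "t' < q" "q < s"
        using Rats_dense_in_real[OF t'(2)] by auto
      have "F x q \<le> 1" using F_mono[of q s x] q s by simp
      then have "ereal t' \<le> (SUP q\<in>\<rat>. if F x q \<le> 1 then ereal q else - \<infinity>)"
        using q by (intro SUP_upper2[of q]) auto
      with t'(1) show "t \<le> (SUP q\<in>\<rat>. if F x q \<le> 1 then ereal q else - \<infinity>)"
        by simp
    qed
  qed
  moreover have "(\<lambda>x. SUP q\<in>\<rat>. if F x q \<le> 1 then ereal q else - \<infinity>) \<in> borel_measurable borel"
    by (rule borel_measurable_SUP) (auto simp: countable_rat)
  ultimately show ?thesis by simp
qed

end

section \<open>Almost everywhere Borel functions of two variables\<close>

lemma ae_of_larger:
  assumes "sets M = sets borel" "sets N = sets borel" "meas_ge N M" "AE y in N. P y"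
  shows "AE y in M. P y"
proof -
  obtain S where S: "S \<in> null_sets N" "{y \<in> space N. \<not> P y} \<subseteq> S"
    using assms(4) by (auto simp: eventually_ae_filter)
  have "emeasure M S \<le> emeasure N S"
    using assms S(1) by (auto simp: meas_ge_def null_sets_def)
  then have "S \<in> null_sets M"
    using S(1) assms by (auto simp: null_sets_def)
  moreover have "space M = space N"
    using assms by (metis sets_eq_imp_space_eq)
  ultimately show ?thesis
    using S(2) by (auto simp: eventually_ae_filter)
qed

lemma nn_integral_le_of_larger:
  assumes "sets M = sets borel" "sets N = sets borel" "meas_ge N M"
  shows "nn_integral M f \<le> nn_integral N f"
  using assms by (intro nn_integral_mono_measure)
    (auto simp: le_measure meas_ge_def)

text \<open>
  The constants \<open>c\<close>, \<open>c'\<close> need not depend measurably on the point, so the functions \<open>A\<^sub>n\<close>, \<open>R\<^sub>n\<close>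
  are only almost everywhere equal to Borel functions.
\<close>

definition unit_borel :: "'a::euclidean_space measure \<Rightarrow> ('a \<Rightarrow> real) \<Rightarrow> bool" where
  "unit_borel M w \<longleftrightarrow> (\<exists>h \<in> borel_measurable borel. (\<forall>y. 0 \<le> h y \<and> h y \<le> 1) \<and> (AE y in M. w y = h y))"

definition ae_borel ::
  "'a::euclidean_space measure \<Rightarrow> 'a measure \<Rightarrow> ('a \<Rightarrow> 'a \<Rightarrow> real) \<Rightarrow> bool" where
  "ae_borel K N g \<longleftrightarrow> (\<exists>g' \<in> borel_measurable (borel \<Otimes>\<^sub>M borel).
     AE z in K \<Otimes>\<^sub>M N. g (fst z) (snd z) = g' z)"

locale lf_pair = K: lf_borel K + N: lf_borel N
  for K N :: "'a::euclidean_space measure"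
begin

sublocale pair_sigma_finite K N ..

lemma sets_pair [simp, measurable_cong]: "sets (K \<Otimes>\<^sub>M N) = sets (borel \<Otimes>\<^sub>M borel)"
  by (rule sets_pair_measure_cong) simp_all

lemma space_pair [simp]: "space (K \<Otimes>\<^sub>M N) = UNIV"
  by (simp add: space_pair_measure)

lemma ae_lift:
  assumes "Measurable.pred (borel \<Otimes>\<^sub>M borel) (\<lambda>z. Q (fst z) (snd z))"
    and "AE x in K. AE y in N. Q x y"
  shows "AE z in K \<Otimes>\<^sub>M N. Q (fst z) (snd z)"
  using assms by (intro AE_pair_measure) (auto simp: pred_def space_pair_measure)

text \<open>\<open>P\<close> need not be measurable, while exchanging the order of the two
  quantifiers requires measurability. The exchange is therefore made for a measurable null set
  containing the exceptional set.\<close>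

lemma ae_swap:
  assumes "AE z in K \<Otimes>\<^sub>M N. P (fst z) (snd z)"
  shows "AE z in N \<Otimes>\<^sub>M K. P (snd z) (fst z)"
proof -
  interpret NK: lf_pair N K ..
  obtain S where S: "S \<in> null_sets (K \<Otimes>\<^sub>M N)" "{z \<in> space (K \<Otimes>\<^sub>M N). \<not> P (fst z) (snd z)} \<subseteq> S"
    using assms by (auto simp: eventually_ae_filter)
  have [measurable]: "S \<in> sets (borel \<Otimes>\<^sub>M borel)"
    using S(1) by (auto simp: null_sets_def)
  have "AE x in K. AE y in N. (x, y) \<notin> S"
    using AE_pair[OF AE_not_in[OF S(1)]] .
  then have "AE y in N. AE x in K. (x, y) \<notin> S"
    by (subst (asm) AE_commute) measurable
  then have "AE z in N \<Otimes>\<^sub>M K. (snd z, fst z) \<notin> S"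
    by (intro NK.ae_lift[where Q = "\<lambda>y x. (x, y) \<notin> S"]) measurable
  then show ?thesis
    by eventually_elim (use S(2) in \<open>auto simp: subset_iff\<close>)
qed

lemma ae_fst:
  assumes "AE x in K. U x"
  shows "AE z in K \<Otimes>\<^sub>M N. U (fst z)"
proof -
  obtain S where S: "S \<in> null_sets K" "{x \<in> space K. \<not> U x} \<subseteq> S"
    using assms by (auto simp: eventually_ae_filter)
  have [measurable]: "S \<in> sets borel"
    using S(1) by (auto simp: null_sets_def)
  have "AE z in K \<Otimes>\<^sub>M N. fst z \<notin> S"
  proof (rule AE_pair_measure)
    show "{x \<in> space (K \<Otimes>\<^sub>M N). fst x \<notin> S} \<in> sets (K \<Otimes>\<^sub>M N)" by measurable
    show "AE x in K. AE y in N. fst (x, y) \<notin> S" 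
      using AE_not_in[OF S(1)] by eventually_elim simp
  qed
  then show ?thesis
    by eventually_elim (use S(2) in auto)
qed

text \<open>A property that holds almost everywhere in each variable in turn need not hold almost
  everywhere for the product measure when it is not measurable. Borel representatives of
  \<open>g\<close> and \<open>h\<close> make the exceptional set measurable.\<close>

lemma ae_lift_le:
  assumes "ae_borel K N g" "ae_borel K N h" "AE x in K. AE y in N. g x y \<le> h x y"
  shows "AE z in K \<Otimes>\<^sub>M N. g (fst z) (snd z) \<le> h (fst z) (snd z)"
proof -
  obtain g' where [measurable]: "g' \<in> borel_measurable (borel \<Otimes>\<^sub>M borel)"
    and g: "AE z in K \<Otimes>\<^sub>M N. g (fst z) (snd z) = g' z"
    using assms by (auto simp: ae_borel_def)
  obtain h' where [measurable]: "h' \<in> borel_measurable (borel \<Otimes>\<^sub>M borel)"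
    and h: "AE z in K \<Otimes>\<^sub>M N. h (fst z) (snd z) = h' z"
    using assms by (auto simp: ae_borel_def)
  have "AE x in K. AE y in N. g' (x, y) \<le> h' (x, y)"
    using AE_pair[OF g] AE_pair[OF h] assms(3)
  proof eventually_elim
    case (elim x)
    then show ?case by eventually_elim simp
  qed
  then have "AE z in K \<Otimes>\<^sub>M N. g' (fst z, snd z) \<le> h' (fst z, snd z)"
    by (intro ae_lift) measurable
  with g h show ?thesis by eventually_elim simp
qed

lemma ae_borelE:
  assumes "ae_borel K N g" "\<And>x y. 0 \<le> g x y \<and> g x y \<le> 1"
  obtains g' where "g' \<in> borel_measurable (borel \<Otimes>\<^sub>M borel)" "\<And>z. 0 \<le> g' z" "\<And>z. g' z \<le> 1"
    "AE z in K \<Otimes>\<^sub>M N. g (fst z) (snd z) = g' z"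
proof -
  obtain h where [measurable]: "h \<in> borel_measurable (borel \<Otimes>\<^sub>M borel)"
    and h: "AE z in K \<Otimes>\<^sub>M N. g (fst z) (snd z) = h z"
    using assms by (auto simp: ae_borel_def)
  show ?thesis
  \<comment> \<open>Clamping the representative to the unit interval changes nothing where it agrees
    with \<open>g\<close>.\<close>
  proof (rule that[of "\<lambda>z. max 0 (min 1 (h z))"])
    show "AE z in K \<Otimes>\<^sub>M N. g (fst z) (snd z) = max 0 (min 1 (h z))"
      using h
    proof eventually_elim
      case (elim z)
      with assms(2)[of "fst z" "snd z"] show ?case by simp
    qed
  qed auto
qed

lemma ae_borel_section:
  assumes "ae_borel K N g" "\<And>x y. 0 \<le> g x y \<and> g x y \<le> 1"
  shows "AE x in K. unit_borel N (g x)"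
proof -
  obtain g' where [measurable]: "g' \<in> borel_measurable (borel \<Otimes>\<^sub>M borel)"
    and g': "\<And>z. 0 \<le> g' z" "\<And>z. g' z \<le> 1" and ae: "AE z in K \<Otimes>\<^sub>M N. g (fst z) (snd z) = g' z"
    using ae_borelE[OF assms] by blast
  from AE_pair[OF ae] show ?thesis
  proof eventually_elim
    case (elim x)
    have "(\<lambda>y. g' (x, y)) \<in> borel_measurable borel" by measurable
    with elim g' show ?case
      unfolding unit_borel_def by (intro bexI[of _ "\<lambda>y. g' (x, y)"]) auto
  qed
qed

lemma ae_borel_swap: "ae_borel K N g \<Longrightarrow> ae_borel N K (\<lambda>y x. g x y)"
proof -
  assume "ae_borel K N g"
  then obtain g' where [measurable]: "g' \<in> borel_measurable (borel \<Otimes>\<^sub>M borel)"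
    and g: "AE z in K \<Otimes>\<^sub>M N. g (fst z) (snd z) = g' (fst z, snd z)"
    by (auto simp: ae_borel_def)
  have "(\<lambda>z. g' (snd z, fst z)) \<in> borel_measurable (borel \<Otimes>\<^sub>M borel)"
    by measurable
  moreover have "AE z in N \<Otimes>\<^sub>M K. g (snd z) (fst z) = g' (snd z, fst z)"
    using ae_swap[of "\<lambda>x y. g x y = g' (x, y)"] g by simp
  ultimately show ?thesis
    unfolding ae_borel_def by (intro bexI[of _ "\<lambda>z. g' (snd z, fst z)"])
qed

lemma ae_borel_diff: 
  assumes "ae_borel K N g" "ae_borel K N h"
  shows "ae_borel K N (\<lambda>x y. g x y - h x y)"
proof -
  obtain g' where [measurable]: "g' \<in> borel_measurable (borel \<Otimes>\<^sub>M borel)"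
    and g: "AE z in K \<Otimes>\<^sub>M N. g (fst z) (snd z) = g' z"
    using assms by (auto simp: ae_borel_def)
  obtain h' where [measurable]: "h' \<in> borel_measurable (borel \<Otimes>\<^sub>M borel)"
    and h: "AE z in K \<Otimes>\<^sub>M N. h (fst z) (snd z) = h' z"
    using assms by (auto simp: ae_borel_def)
  have "AE z in K \<Otimes>\<^sub>M N. g (fst z) (snd z) - h (fst z) (snd z) = g' z - h' z"
    using g h by eventually_elim simp
  moreover have "(\<lambda>z. g' z - h' z) \<in> borel_measurable (borel \<Otimes>\<^sub>M borel)"
    by measurable
  ultimately show ?thesis
    unfolding ae_borel_def by (intro bexI[of _ "\<lambda>z. g' z - h' z"])
qed

end

text \<open>
  \<open>M\<close> is the measure that is integrated, \<open>N\<close> the one whose null sets count: \<open>M = N = \<psi>\<close> for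
  sites, \<open>M = \<phi>\<close> and \<open>N = \<mu>\<close> for centers.
\<close>

locale lf_dominated = N: lf_borel N + M: lf_borel M
  for N M :: "'a::euclidean_space measure" +
  assumes NM: "meas_ge N M"
begin

lemma ae_M: "AE y in N. P y \<Longrightarrow> AE y in M. P y"
  by (rule ae_of_larger[OF _ _ NM]) simp_all

lemma nn_integral_M_le_N: "nn_integral M g \<le> nn_integral N g"
  by (rule nn_integral_le_of_larger[OF _ _ NM]) simp_all

text \<open>Up to an \<open>N\<close>-null set, which is also \<open>M\<close>-null, the sphere is
  one point \<open>s\<close>. If \<open>w s\<close> were nonzero, the hypothesis on \<open>w\<close>
  would make the sphere \<open>M\<close>-null.\<close>

lemma AE_zero_on_atomic_sphere:
  assumes "atomic_spheres N x" "AE y in M. ereal (dist x y) = \<rho> \<longrightarrow> w y = 0"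
    and "emeasure M {y. ereal (dist x y) = \<rho>} \<noteq> 0"
  shows "AE y in N. ereal (dist x y) = \<rho> \<longrightarrow> w y = 0"
proof -
  obtain s where s: "AE y in N. ereal (dist x y) = \<rho> \<longrightarrow> y = s"
    using atomic_spheresE[OF assms(1) N.sets_eq] .
  have "w s = 0"
  proof (rule ccontr)
    assume n: "w s \<noteq> 0"
    have "AE y in M. \<not> ereal (dist x y) = \<rho>"
      using assms(2) ae_M[OF s] by eventually_elim (use n in auto)
    then have "emeasure M {y. ereal (dist x y) = \<rho>} = 0"
      by (subst (asm) AE_iff_measurable[of "{y. ereal (dist x y) = \<rho>}"]) auto
    with assms(3) show False ..
  qed
  with s show ?thesis by (auto elim: eventually_mono)
qed

end

section \<open>Cuts of almost everywhere Borel functions\<close>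

locale lf_triple = lf_pair K N + lf_dominated N M
  for K N M :: "'a::euclidean_space measure"
begin

text \<open>
  The equation \<open>\<integral> cut_fun = 1\<close> determines \<open>\<theta>\<close> unless \<open>w\<close> vanishes \<open>M\<close>-a.e. on the bounding
  sphere. If that sphere is not \<open>M\<close>-null, it has a single atom, so \<open>w\<close> vanishes on it even
  \<open>N\<close>-a.e. and the value of \<open>\<theta>\<close> is irrelevant.
\<close>

lemma cut_ae_borel:
  fixes w :: "'a \<Rightarrow> 'a \<Rightarrow> real"
  assumes w: "ae_borel K N w" "\<And>x y. 0 \<le> w x y \<and> w x y \<le> 1"
    and atomic: "AE x in K. atomic_spheres N x"
    and cut: "\<And>x. is_cut M x (w x) (\<rho> x) (\<theta> x) \<theta>0"
  shows "\<exists>\<rho>'\<in>borel_measurable borel. AE x in K. \<rho> x = \<rho>' x"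
    and "ae_borel K N (\<lambda>x. cut_fun x (\<rho> x) (\<theta> x) (w x))"
proof -
  obtain w' where w'[measurable]: "w' \<in> borel_measurable (borel \<Otimes>\<^sub>M borel)"
    and b: "\<And>z. 0 \<le> w' z" "\<And>z. w' z \<le> 1"
    and ww': "AE z in K \<Otimes>\<^sub>M N. w (fst z) (snd z) = w' z"
    using ae_borelE[OF w] by blast
  have cut': "AE x in K. is_cut M x (\<lambda>y. w' (x, y)) (\<rho> x) (\<theta> x) \<theta>0"
    using AE_pair[OF ww']
  proof eventually_elim
    case (elim x)
    then have "AE y in M. w x y = w' (x, y)" by (intro ae_M) simp
    from is_cut_cong_AE[OF this cut] show ?case .
  qed
  define \<rho>' where "\<rho>' x = cut_radius M x (\<lambda>y. w' (x, y))" for x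
  have \<rho>'[measurable]: "\<rho>' \<in> borel_measurable borel"
    unfolding \<rho>'_def by (rule M.borel_measurable_cut_radius) fact
  have \<rho>\<rho>': "AE x in K. \<rho> x = \<rho>' x"
    using cut' by eventually_elim (simp add: \<rho>'_def is_cut_def)
  then show "\<exists>\<rho>'\<in>borel_measurable borel. AE x in K. \<rho> x = \<rho>' x"
    using \<rho>' by blast
  define B where "B x = ball_mass M x (\<rho>' x) (\<lambda>y. w' (x, y))" for x
  define S where "S x = sphere_mass M x (\<rho>' x) (\<lambda>y. w' (x, y))" for x
  \<comment> \<open>With weight 1 this is the \<open>M\<close>-measure of the bounding sphere;
    \<open>T x = 0\<close> is the case in which \<open>\<theta>0\<close> is prescribed.\<close>
  define T where "T x = sphere_mass M x (\<rho>' x) (\<lambda>y. 1)" for x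
  have [measurable]: "B \<in> borel_measurable borel" "S \<in> borel_measurable borel" "T \<in> borel_measurable borel"
    unfolding B_def S_def T_def
    using M.borel_measurable_masses[OF w' \<rho>'] M.borel_measurable_masses[OF _ \<rho>', of "\<lambda>_. 1"] by simp_all
  \<comment> \<open>The solution of \<open>B x + \<theta> * S x = 1\<close>, a Borel function of
    \<open>x\<close>.\<close>
  define \<theta>' where "\<theta>' x = (if S x = 0 then \<theta>0 else enn2real ((1 - B x) / S x))" for x
  have [measurable]: "\<theta>' \<in> borel_measurable borel"
    unfolding \<theta>'_def by measurable
  \<comment> \<open>No point lies at infinite distance, so \<open>\<theta>\<close> matters only for
    a finite radius. The undetermined case \<open>S x = 0\<close>, \<open>T x \<noteq> 0\<close> is
    left to \<open>Q\<close>.\<close>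
  have U: "AE x in K. \<rho> x = \<rho>' x \<and> (\<rho> x < \<infinity> \<longrightarrow> \<theta> x = \<theta>' x \<or> (S x = 0 \<and> T x \<noteq> 0))"
    using cut' \<rho>\<rho>'
  proof eventually_elim
    case (elim x)
    have "\<theta> x = \<theta>' x" if fin: "\<rho> x < \<infinity>" and n: "\<not> (S x = 0 \<and> T x \<noteq> 0)"
    proof (cases "S x = 0")
      case True
      with n have "T x = 0" by simp
      moreover have "T x = emeasure M (sphere x (real_of_ereal (\<rho> x)))"
      proof -
        have "\<rho> x \<noteq> -\<infinity>" using elim by (auto simp: is_cut_def cut_radius_not_MInf)
        then have "{y. ereal (dist x y) = \<rho> x} = sphere x (real_of_ereal (\<rho> x))"
          using fin sphere_eq_ereal by blast
        then show ?thesis using elim by (simp add: T_def sphere_mass_def)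
      qed
      ultimately have "\<theta> x = \<theta>0"
        using elim(1) fin unfolding is_cut_def by metis
      then show ?thesis using True by (simp add: \<theta>'_def)
    next
      case False
      have "B x + ennreal (\<theta> x) * S x = 1"
        unfolding B_def S_def elim(2)[symmetric]
        by (rule M.is_cut_masses[OF _ _ elim(1) fin]) (use b in auto)
      moreover have "S x < \<infinity>"
        unfolding S_def using elim(2) fin b by (intro M.sphere_mass_finite) auto
      moreover have "B x \<noteq> top"
        using calculation(1) by (metis ennreal_add_eq_top ennreal_one_neq_top)
      ultimately have "(1 - B x) / S x = ennreal (\<theta> x)"
        using False by (metis ennreal_add_diff_cancel_left infinity_ennreal_def less_irrefl mult_divide_eq_ennreal)
      then show ?thesis
        using elim(1) False by (simp add: \<theta>'_def is_cut_def)
    qed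
    with elim show ?case by blast
  qed
  define Q where "Q x y \<longleftrightarrow> (ereal (dist x y) = \<rho>' x \<and> S x = 0 \<and> T x \<noteq> 0 \<longrightarrow> w' (x, y) = 0)" for x y
  have "AE x in K. AE y in N. Q x y"
    using atomic
  proof eventually_elim
    case (elim x)
    show ?case
    proof (cases "S x = 0 \<and> T x \<noteq> 0")
      case True
      from True have "AE y in M. ennreal (w' (x, y)) * indicator {y. ereal (dist x y) = \<rho>' x} y = 0"
        unfolding S_def sphere_mass_def by (subst (asm) nn_integral_0_iff_AE) auto
      then have 0: "AE y in M. ereal (dist x y) = \<rho>' x \<longrightarrow> w' (x, y) = 0"
        by eventually_elim (use b in \<open>auto simp: indicator_def ennreal_eq_0_iff intro: antisym\<close>)
      have "AE y in N. ereal (dist x y) = \<rho>' x \<longrightarrow> w' (x, y) = 0"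
        using AE_zero_on_atomic_sphere[OF elim 0] True by (simp add: T_def sphere_mass_def)
      then show ?thesis unfolding Q_def by eventually_elim simp
    qed (auto simp: Q_def)
  qed
  then have Q: "AE z in K \<Otimes>\<^sub>M N. Q (fst z) (snd z)"
    by (rule ae_lift[rotated]) (unfold Q_def, measurable)
  let ?G = "\<lambda>z. cut_fun (fst z) (\<rho>' (fst z)) (\<theta>' (fst z)) (\<lambda>y. w' (fst z, y)) (snd z)"
  have "?G \<in> borel_measurable (borel \<Otimes>\<^sub>M borel)"
    unfolding cut_fun_def by measurable
  moreover have "AE z in K \<Otimes>\<^sub>M N. cut_fun (fst z) (\<rho> (fst z)) (\<theta> (fst z)) (w (fst z)) (snd z) = ?G z"
    using ae_fst[OF U] Q ww'
  proof eventually_elim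
    case (elim z)
    then show ?case by (cases z) (auto simp: cut_fun_def Q_def)
  qed
  ultimately show "ae_borel K N (\<lambda>x. cut_fun x (\<rho> x) (\<theta> x) (w x))"
    unfolding ae_borel_def by (intro bexI[of _ ?G])
qed

end

section \<open>Comparison at a single point\<close>

lemma AE_eq_of_nn_integral_le:
  fixes f g :: "'a \<Rightarrow> ennreal"
  assumes [measurable]: "f \<in> borel_measurable M" "g \<in> borel_measurable M"
    and "AE x in M. f x \<le> g x" "nn_integral M g \<le> nn_integral M f" "nn_integral M f \<noteq> \<infinity>"
  shows "AE x in M. f x = g x"
proof -
  have "(\<integral>\<^sup>+ x. (g x - f x) \<partial>M) = nn_integral M g - nn_integral M f"
    using assms by (intro nn_integral_diff) auto
  also have "\<dots> = 0"
    using assms(4,5) by (simp add: diff_eq_0_iff_ennreal less_top)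
  finally have "AE x in M. g x - f x = 0"
    by (subst (asm) nn_integral_0_iff_AE) auto
  with assms(3) show ?thesis
    by eventually_elim (auto simp: diff_eq_0_iff_ennreal)
qed

lemma unit_borel_mono_measure:
  assumes "unit_borel N w" "\<And>P. AE y in N. P y \<Longrightarrow> AE y in M. P y"
  shows "unit_borel M w"
  using assms unfolding unit_borel_def by blast

lemma is_cut_fraction:
  assumes "is_cut M x w \<rho> \<theta> \<theta>0"
  shows "0 \<le> \<theta>" "\<theta> \<le> 1"
  using assms by (auto simp: is_cut_def)

lemma is_cut_not_MInf: "is_cut M x w \<rho> \<theta> \<theta>0 \<Longrightarrow> \<rho> \<noteq> - \<infinity>"
  using cut_radius_not_MInf[of M x w] by (simp only: is_cut_def not_False_eq_True)

lemma unit_borel_cut_fun: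
  assumes "unit_borel M w" "0 \<le> \<theta>" "\<theta> \<le> 1"
  shows "unit_borel M (cut_fun x \<rho> \<theta> w)"
proof -
  obtain h where [measurable]: "h \<in> borel_measurable borel"
    and h: "\<And>y. 0 \<le> h y" "\<And>y. h y \<le> 1" "AE y in M. w y = h y"
    using assms(1) by (auto simp: unit_borel_def)
  have "cut_fun x \<rho> \<theta> h \<in> borel_measurable borel"
    unfolding cut_fun_def by measurable
  moreover have "0 \<le> cut_fun x \<rho> \<theta> h y \<and> cut_fun x \<rho> \<theta> h y \<le> 1" for y
    using cut_fun_bounds[of \<theta> h y x \<rho>] assms(2,3) h(1)[of y] h(2)[of y] by simp
  moreover have "AE y in M. cut_fun x \<rho> \<theta> w y = cut_fun x \<rho> \<theta> h y"
    using h(3) by eventually_elim (simp add: cut_fun_def)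
  ultimately show ?thesis
    unfolding unit_borel_def by (intro bexI[of _ "cut_fun x \<rho> \<theta> h"]) auto
qed

section \<open>Limits of integrals of almost everywhere Borel functions\<close>

context lf_borel
begin

lemma unit_borel_seq:
  assumes "\<And>n::nat. unit_borel M (u n)"
  shows "\<exists>h. (\<forall>n. h n \<in> borel_measurable M) \<and> (\<forall>n y. h n y \<le> (1::real)) \<and>
    (AE y in M. \<forall>n. u n y = h n y)"
proof -
  have "\<forall>n. \<exists>h. h \<in> borel_measurable M \<and> (\<forall>y. h y \<le> 1) \<and> (AE y in M. u n y = h y)"
    using assms unfolding unit_borel_def measurable_cong_sets[OF sets_eq refl] by blast
  then obtain h where "\<And>n. h n \<in> borel_measurable M" "\<And>n. \<forall>y. h n y \<le> 1"
    and eq: "\<forall>n. AE y in M. u n y = h n y"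
    by metis
  then show ?thesis
    using eq by (intro exI[of _ h]) (simp add: AE_all_countable)
qed

text \<open>Fatou's lemma, applied to Borel representatives chosen for the whole sequence at
  once.\<close>

lemma nn_integral_lim_le_1:
  assumes u: "\<And>n::nat. unit_borel M (u n)" and le: "\<And>n. (\<integral>\<^sup>+ y. ennreal (u n y) \<partial>M) \<le> 1"
    and lim: "\<And>y. (\<lambda>n. ennreal (u n y)) \<longlonglongrightarrow> F y"
  shows "(\<integral>\<^sup>+ y. F y \<partial>M) \<le> 1"
proof -
  obtain h where h: "\<forall>n. h n \<in> borel_measurable M" and eq: "AE y in M. \<forall>n. u n y = h n y"
    using unit_borel_seq[of u] u by blast
  note [measurable] = h[rule_format]
  have "(\<integral>\<^sup>+ y. F y \<partial>M) = (\<integral>\<^sup>+ y. liminf (\<lambda>n. ennreal (h n y)) \<partial>M)"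
  proof (rule nn_integral_cong_AE, use eq in eventually_elim)
    case (elim y)
    then show ?case
      using lim_imp_Liminf[OF _ lim[of y]] by simp
  qed
  also have "\<dots> \<le> liminf (\<lambda>n. \<integral>\<^sup>+ y. ennreal (h n y) \<partial>M)"
    by (rule nn_integral_liminf) auto
  also have "(\<lambda>n. \<integral>\<^sup>+ y. ennreal (h n y) \<partial>M) = (\<lambda>n. \<integral>\<^sup>+ y. ennreal (u n y) \<partial>M)"
    by (intro ext nn_integral_cong_AE) (use eq in eventually_elim, simp)
  also have "liminf \<dots> \<le> 1"
    using le by (intro Liminf_le) auto
  finally show ?thesis .
qed

text \<open>Dominated convergence: from some index on, the functions are bounded almost everywhere
  by the indicator of one ball of finite measure, so no mass escapes to infinity.\<close>

lemma nn_integral_lim_eq_1: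
  assumes u: "\<And>n::nat. unit_borel M (u n)"
    and eq1: "\<forall>\<^sub>F n in sequentially. (\<integral>\<^sup>+ y. ennreal (u n y) \<partial>M) = 1"
    and supp: "\<forall>\<^sub>F n in sequentially. \<forall>y. y \<notin> cball x b \<longrightarrow> u n y = 0"
    and lim: "\<And>y. (\<lambda>n. ennreal (u n y)) \<longlonglongrightarrow> F y"
  shows "(\<integral>\<^sup>+ y. F y \<partial>M) = 1"
proof -
  obtain n0 where n0: "\<And>n. n0 \<le> n \<Longrightarrow> (\<integral>\<^sup>+ y. ennreal (u n y) \<partial>M) = 1"
    "\<And>n y. n0 \<le> n \<Longrightarrow> y \<notin> cball x b \<Longrightarrow> u n y = 0"
    using eventually_conj[OF eq1 supp] by (auto simp: eventually_sequentially)
  obtain h where h: "\<forall>n. h n \<in> borel_measurable M" and h1: "\<forall>n y. h n y \<le> 1"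
    and eq: "AE y in M. \<forall>n. u n y = h n y"
    using unit_borel_seq[of u] u by blast
  note [measurable] = h[rule_format]
  \<comment> \<open>\<open>F\<close> need not be measurable, but the limit of the representatives
    is. The shift by \<open>n0\<close> makes the mass and support conditions hold for every
    index.\<close>
  define F' where "F' y = lim (\<lambda>n. ennreal (h (n + n0) y))" for y
  have [measurable]: "F' \<in> borel_measurable M" unfolding F'_def by measurable
  have F': "AE y in M. F y = F' y \<and> (\<lambda>n. ennreal (h (n + n0) y)) \<longlonglongrightarrow> F' y"
    using eq
  proof eventually_elim
    case (elim y)
    have "(\<lambda>n. ennreal (h (n + n0) y)) \<longlonglongrightarrow> F y"
      using LIMSEQ_ignore_initial_segment[OF lim[of y], of n0] elim by simp
    then show ?case unfolding F'_def by (metis limI)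
  qed
  have "(\<lambda>n. \<integral>\<^sup>+ y. ennreal (h (n + n0) y) \<partial>M) \<longlonglongrightarrow> (\<integral>\<^sup>+ y. F' y \<partial>M)"
  proof (rule nn_integral_dominated_convergence)
    show "AE y in M. ennreal (h (n + n0) y) \<le> indicator (cball x b) y" for n
      using eq
    proof eventually_elim
      case (elim y)
      then show ?case
        using n0(2)[of "n + n0" y] h1[rule_format, of "n + n0" y] by (auto simp: indicator_def)
    qed
    show "(\<integral>\<^sup>+ y. indicator (cball x b) y \<partial>M) < \<infinity>"
      using emeasure_cball_finite by simp
    show "indicator (cball x b) \<in> borel_measurable M"
      by (rule borel_measurable_indicator) simp
    show "AE y in M. (\<lambda>n. ennreal (h (n + n0) y)) \<longlonglongrightarrow> F' y"
      using F' by eventually_elim simp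
  qed auto
  moreover have "(\<integral>\<^sup>+ y. ennreal (h (n + n0) y) \<partial>M) = 1" for n
  proof -
    have "(\<integral>\<^sup>+ y. ennreal (h (n + n0) y) \<partial>M) = (\<integral>\<^sup>+ y. ennreal (u (n + n0) y) \<partial>M)"
      by (rule nn_integral_cong_AE) (use eq in eventually_elim, simp)
    then show ?thesis using n0(1) by simp
  qed
  ultimately have "(\<integral>\<^sup>+ y. F' y \<partial>M) = 1"
    by (simp add: LIMSEQ_const_iff)
  moreover have "(\<integral>\<^sup>+ y. F y \<partial>M) = (\<integral>\<^sup>+ y. F' y \<partial>M)"
    by (rule nn_integral_cong_AE) (use F' in eventually_elim, simp)
  ultimately show ?thesis by simp
qed

lemma nn_integral_cut_le_1:
  assumes "unit_borel M w" "is_cut M x w \<rho> \<theta> \<theta>0"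
  shows "(\<integral>\<^sup>+ y. ennreal (cut_fun x \<rho> \<theta> w y) \<partial>M) \<le> 1"
proof -
  obtain h where h: "h \<in> borel_measurable borel" "AE y in M. w y = h y"
    using assms(1) by (auto simp: unit_borel_def)
  have "(\<integral>\<^sup>+ y. ennreal (cut_fun x \<rho> \<theta> w y) \<partial>M) = (\<integral>\<^sup>+ y. ennreal (cut_fun x \<rho> \<theta> h y) \<partial>M)"
    by (rule nn_integral_cong_AE) (use h(2) in eventually_elim, simp add: cut_fun_def)
  also have "\<dots> \<le> 1"
    using nn_integral_cut_le_1_borel[OF h(1) is_cut_cong_AE[OF h(2) assms(2)]] .
  finally show ?thesis .
qed

lemma cut_fraction_antimono:
  assumes "unit_borel M w1" "unit_borel M w2" "AE y in M. w1 y \<le> w2 y"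
    and c1: "is_cut M x w1 \<rho> \<theta>1 \<theta>0" and c2: "is_cut M x w2 \<rho> \<theta>2 \<theta>0'" and fin: "\<rho> < \<infinity>"
  shows "\<theta>2 \<le> \<theta>1 \<or> (AE y in M. ereal (dist x y) = \<rho> \<longrightarrow> w1 y = 0)"
proof -
  obtain h1 where h1: "h1 \<in> borel_measurable borel" "\<And>y. 0 \<le> h1 y" "\<And>y. h1 y \<le> 1" "AE y in M. w1 y = h1 y"
    using assms(1) by (auto simp: unit_borel_def)
  obtain h2 where h2: "h2 \<in> borel_measurable borel" "\<And>y. 0 \<le> h2 y" "\<And>y. h2 y \<le> 1" "AE y in M. w2 y = h2 y"
    using assms(2) by (auto simp: unit_borel_def)
  have "AE y in M. h1 y \<le> h2 y"
    using h1(4) h2(4) assms(3) by eventually_elim simp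
  from cut_fraction_antimono_borel[OF h1(1) h2(1) h1(2,3) h2(2,3) this is_cut_cong_AE[OF h1(4) c1]
      is_cut_cong_AE[OF h2(4) c2] fin]
  have "\<theta>2 \<le> \<theta>1 \<or> (AE y in M. ereal (dist x y) = \<rho> \<longrightarrow> h1 y = 0)" .
  then show ?thesis
  proof
    assume "AE y in M. ereal (dist x y) = \<rho> \<longrightarrow> h1 y = 0"
    with h1(4) have "AE y in M. ereal (dist x y) = \<rho> \<longrightarrow> w1 y = 0"
      by eventually_elim simp
    then show ?thesis ..
  qed simp
qed

end

text \<open>If \<open>y\<close> is neither inside the ball nor farther than \<open>y0\<close>, both
  points lie on the bounding sphere and hence coincide with its atom \<open>s\<close>. This resolves
  the ties in the two comparisons below.\<close>

lemma cut_trichotomy: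
  assumes "ereal (dist x y0) \<le> \<rho>" "ereal (dist x y0) = \<rho> \<longrightarrow> y0 = s" "ereal (dist x y) = \<rho> \<longrightarrow> y = s"
  obtains "ereal (dist x y) < \<rho>" | "y = y0" | "dist x y0 < dist x y"
proof (cases "ereal (dist x y) < \<rho> \<or> dist x y0 < dist x y")
  case False
  then have "\<not> ereal (dist x y) < \<rho>" "ereal (dist x y) \<le> ereal (dist x y0)" by auto
  with assms(1) have "ereal (dist x y) = \<rho>" "ereal (dist x y0) = \<rho>" by order+
  with assms that(2) show ?thesis by simp
qed (use that in blast)

section \<open>Comparing a function with a cut\<close>

context lf_dominated
begin

text \<open>
  The conclusion says that \<open>u\<close> has positive mass, not just a positive value, beyond \<open>y\<close>: unlike
  the existential condition, this depends measurably on the pair \<open>(x, y)\<close>.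
\<close>

lemma AE_cut_le_or_farther_mass:
  assumes w: "unit_borel N w" and cut: "is_cut N x w \<rho> \<theta> \<theta>0" and atomic: "atomic_spheres N x"
    and [measurable]: "u \<in> borel_measurable borel" and u0: "\<And>y. 0 \<le> u y"
    and uw: "AE y in N. u y \<le> w y" and mass: "(\<integral>\<^sup>+ y. ennreal (u y) \<partial>M) = 1"
  shows "AE y in N. u y < cut_fun x \<rho> \<theta> w y \<longrightarrow>
    (\<integral>\<^sup>+ y'. ennreal (u y') * indicator {y'. dist x y < dist x y'} y' \<partial>M) \<noteq> 0"
proof -
  obtain h where h [measurable]: "h \<in> borel_measurable borel"
    and h0: "\<And>y. 0 \<le> h y" "\<And>y. h y \<le> 1" and wh: "AE y in N. w y = h y"
    using w by (auto simp: unit_borel_def)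
  define G where "G = cut_fun x \<rho> \<theta> h"
  have cut': "is_cut N x h \<rho> \<theta> \<theta>0" by (rule is_cut_cong_AE[OF wh cut])
  have [measurable]: "G \<in> borel_measurable borel" unfolding G_def cut_fun_def by measurable
  have G0: "0 \<le> G y" for y
    using cut_fun_bounds(1)[of \<theta> h y x \<rho>] is_cut_fraction[OF cut'] h0(1) by (simp add: G_def)
  have uh: "AE y in N. u y \<le> h y" using uw wh by eventually_elim simp
  have iG: "(\<integral>\<^sup>+ y. ennreal (G y) \<partial>N) \<le> 1"
    unfolding G_def by (rule N.nn_integral_cut_le_1_borel[OF h cut'])
  \<comment> \<open>The \<open>N\<close>-mass of \<open>v\<close> is at least its
    \<open>M\<close>-mass 1, and that of \<open>G\<close> is at most 1, so a function below
    \<open>G\<close> has no room to differ from it.\<close>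
  have eq: "AE y in N. v y = G y"
    if [measurable]: "v \<in> borel_measurable borel" and v0: "\<And>y. 0 \<le> v y"
      and le: "AE y in N. v y \<le> G y" and mass: "(\<integral>\<^sup>+ y. ennreal (v y) \<partial>M) = 1" for v
  proof -
    have le': "AE y in N. ennreal (v y) \<le> ennreal (G y)"
      using le by eventually_elim (simp add: ennreal_leI)
    have "1 \<le> (\<integral>\<^sup>+ y. ennreal (v y) \<partial>N)"
      using nn_integral_M_le_N[of "\<lambda>y. ennreal (v y)"] mass by simp
    moreover have "(\<integral>\<^sup>+ y. ennreal (v y) \<partial>N) \<le> 1"
      using nn_integral_mono_AE[OF le'] iG by simp
    ultimately have "(\<integral>\<^sup>+ y. ennreal (v y) \<partial>N) = 1" by simp
    then have "AE y in N. ennreal (v y) = ennreal (G y)"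
      using le' iG by (intro AE_eq_of_nn_integral_le) auto
    then show ?thesis
      by eventually_elim (simp add: v0 G0)
  qed
  obtain s where s: "AE y in N. ereal (dist x y) = \<rho> \<longrightarrow> y = s"
    using atomic_spheresE[OF atomic N.sets_eq] .
  define far where "far y = (\<integral>\<^sup>+ y'. ennreal (u y') * indicator {y'. dist x y < dist x y'} y' \<partial>M)" for y
  define S where "S y \<longleftrightarrow> u y < G y \<and> far y = 0" for y
  have "AE y in N. \<not> S y"
  \<comment> \<open>One bad point \<open>y0\<close> inside the ball or at the atom of the sphere
    suffices for the argument. If there is none, almost every point is good, because
    \<open>G\<close> vanishes outside the closed ball.\<close>
  proof (cases "\<exists>y0. S y0 \<and> ereal (dist x y0) \<le> \<rho> \<and> (ereal (dist x y0) = \<rho> \<longrightarrow> y0 = s)")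
    case True
    then obtain y0 where y0: "S y0" "ereal (dist x y0) \<le> \<rho>" "ereal (dist x y0) = \<rho> \<longrightarrow> y0 = s"
      by blast
    \<comment> \<open>Truncating \<open>u\<close> beyond \<open>y0\<close> loses no mass, since
      \<open>far y0 = 0\<close>. The truncation lies below \<open>G\<close>: inside the ball
      \<open>G = h\<close>, at \<open>y0\<close> it holds by choice, and farther out
      \<open>v = 0\<close>.\<close>
    define v where "v y = (if dist x y \<le> dist x y0 then u y else 0)" for y
    have v [measurable]: "v \<in> borel_measurable borel" unfolding v_def by measurable
    have "(\<integral>\<^sup>+ y. ennreal (u y) \<partial>M) =
        (\<integral>\<^sup>+ y. ennreal (v y) + ennreal (u y) * indicator {y'. dist x y0 < dist x y'} y \<partial>M)"
      by (rule nn_integral_cong) (simp add: v_def indicator_def)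
    also have "\<dots> = (\<integral>\<^sup>+ y. ennreal (v y) \<partial>M) + far y0"
      unfolding far_def by (rule nn_integral_add) auto
    finally have mass_v: "(\<integral>\<^sup>+ y. ennreal (v y) \<partial>M) = 1"
      using mass y0(1) by (simp add: S_def)
    have "AE y in N. v y \<le> G y"
      using uh s
    proof eventually_elim
      case (elim y)
      consider "ereal (dist x y) < \<rho>" | "y = y0" | "dist x y0 < dist x y"
        using cut_trichotomy[OF y0(2,3) elim(2)] .
      then show ?case
      proof cases
        case 1 then show ?thesis using elim(1) h0(1)[of y] by (simp add: G_def cut_fun_def v_def)
      next
        case 2 then show ?thesis using y0(1) by (simp add: S_def v_def)
      next
        case 3 then show ?thesis using G0[of y] by (simp add: v_def)
      qed
    qed
    from eq[OF v _ this mass_v] have "AE y in N. v y = G y"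
      using u0 by (simp add: v_def)
    then show ?thesis
    proof eventually_elim
      case (elim y)
      have "v y \<le> u y" using u0[of y] by (simp add: v_def)
      with elim show ?case by (simp add: S_def)
    qed
  next
    case False
    from s show ?thesis
    proof eventually_elim
      case (elim y)
      show ?case
      proof
        assume y: "S y"
        then have "G y > 0" using u0[of y] by (simp add: S_def)
        then have "ereal (dist x y) \<le> \<rho>"
          by (simp add: G_def cut_fun_def split: if_splits)
        with y elim False show False by blast
      qed
    qed
  qed
  with wh show ?thesis
  proof eventually_elim
    case (elim y)
    from elim have "cut_fun x \<rho> \<theta> w y = G y" by (simp add: G_def cut_fun_def)
    with elim show ?case unfolding S_def far_def by simp
  qed
qed

text \<open>The difference \<open>w - cut_fun\<close> is the rejected part. If \<open>u\<close>
  dominates the cut \<open>M\<close>-a.e., both have \<open>M\<close>-mass 1 and \<open>u\<close>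
  has no \<open>N\<close>-mass to spare. Otherwise \<open>u\<close> falls below the cut at some
  point of the closed ball and vanishes farther away, while nothing is rejected inside the
  ball.\<close>

lemma AE_uncut_bound:
  assumes w: "unit_borel N w" and cut: "is_cut M x w \<rho> \<theta> \<theta>0" and atomic: "atomic_spheres N x"
    and [measurable]: "u \<in> borel_measurable borel" and u: "\<And>y. 0 \<le> u y" "\<And>y. u y \<le> 1"
    and mass: "(\<integral>\<^sup>+ y. ennreal (u y) \<partial>N) \<le> 1"
    and below: "AE y in N. u y < cut_fun x \<rho> \<theta> w y \<longrightarrow> (\<forall>y'. dist x y < dist x y' \<longrightarrow> u y' = 0)"
  shows "AE y in N. u y + (w y - cut_fun x \<rho> \<theta> w y) \<le> 1"
proof (cases "\<rho> < \<infinity>")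
  case False
  then show ?thesis using u by (simp add: cut_fun_def)
next
  case True
  obtain h where h [measurable]: "h \<in> borel_measurable borel"
    and h0: "\<And>y. 0 \<le> h y" "\<And>y. h y \<le> 1" and wh: "AE y in N. w y = h y"
    using w by (auto simp: unit_borel_def)
  define G where "G = cut_fun x \<rho> \<theta> h"
  have cut': "is_cut M x h \<rho> \<theta> \<theta>0" by (rule is_cut_cong_AE[OF ae_M[OF wh] cut])
  have [measurable]: "G \<in> borel_measurable borel" unfolding G_def cut_fun_def by measurable
  have G0: "0 \<le> G y" "G y \<le> h y" for y
    using cut_fun_bounds[of \<theta> h y x \<rho>] is_cut_fraction[OF cut'] h0(1) by (simp_all add: G_def)
  have iG: "(\<integral>\<^sup>+ y. ennreal (G y) \<partial>M) = 1"
    using cut' True unfolding G_def is_cut_def by blast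
  have below': "AE y in N. u y < G y \<longrightarrow> (\<forall>y'. dist x y < dist x y' \<longrightarrow> u y' = 0)"
    using below wh
  proof eventually_elim
    case (elim y)
    from elim have "cut_fun x \<rho> \<theta> w y = G y" by (simp add: G_def cut_fun_def)
    with elim(1) show ?case by (simp only:)
  qed
  have "AE y in N. u y + (h y - G y) \<le> 1"
  proof (cases "AE y in M. G y \<le> u y")
    case le: True
    have le': "AE y in M. ennreal (G y) \<le> ennreal (u y)"
      using le by eventually_elim (simp add: ennreal_leI)
    have iu: "(\<integral>\<^sup>+ y. ennreal (u y) \<partial>M) \<le> 1"
      using nn_integral_M_le_N[of "\<lambda>y. ennreal (u y)"] mass by simp
    have "AE y in M. ennreal (G y) = ennreal (u y)"
      using le' iu iG by (intro AE_eq_of_nn_integral_le) auto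
    then have eqM: "AE y in M. G y = u y"
      by eventually_elim (simp add: u G0)
    \<comment> \<open>\<open>b\<close> keeps \<open>u\<close> only where the bound holds.
      \<open>M\<close>-a.e. \<open>G = u\<close>, where the bound reads \<open>h \<le> 1\<close>, so
      \<open>b\<close> already has mass 1. Hence \<open>u\<close> vanishes almost everywhere that
      the bound fails, which is contradictory because \<open>h - G \<le> 1\<close>.\<close>
    define b where "b y = (if u y + (h y - G y) \<le> 1 then ennreal (u y) else 0)" for y
    have [measurable]: "b \<in> borel_measurable borel" unfolding b_def by measurable
    have "1 = (\<integral>\<^sup>+ y. b y \<partial>M)"
      unfolding iG[symmetric]
      by (rule nn_integral_cong_AE) (use eqM in eventually_elim, use h0 in \<open>auto simp: b_def\<close>)
    also have "\<dots> \<le> (\<integral>\<^sup>+ y. b y \<partial>N)" by (rule nn_integral_M_le_N)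
    finally have b1: "1 \<le> (\<integral>\<^sup>+ y. b y \<partial>N)" .
    have bu: "(\<integral>\<^sup>+ y. b y \<partial>N) \<le> (\<integral>\<^sup>+ y. ennreal (u y) \<partial>N)"
      by (rule nn_integral_mono) (simp add: b_def)
    have "AE y in N. b y = ennreal (u y)"
    proof (rule AE_eq_of_nn_integral_le)
      show "(\<integral>\<^sup>+ y. ennreal (u y) \<partial>N) \<le> (\<integral>\<^sup>+ y. b y \<partial>N)" using b1 mass by simp
      show "(\<integral>\<^sup>+ y. b y \<partial>N) \<noteq> \<infinity>" using bu mass by (auto simp: top_unique)
    qed (auto simp: b_def)
    then show ?thesis
    proof eventually_elim
      case (elim y)
      show ?case
      proof (rule ccontr)
        assume c: "\<not> u y + (h y - G y) \<le> 1"
        with elim have "ennreal (u y) = 0" by (simp add: b_def)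
        then have "u y = 0" using u(1)[of y] by (simp add: ennreal_eq_0_iff)
        with c h0(2)[of y] G0(1)[of y] show False by simp
      qed
    qed
  next
    case False
    then have nN: "\<not> (AE y in N. G y \<le> u y)" using ae_M by blast
    obtain s where s: "AE y in N. ereal (dist x y) = \<rho> \<longrightarrow> y = s"
      using atomic_spheresE[OF atomic N.sets_eq] .
    \<comment> \<open>The set where \<open>u < G\<close> is not \<open>N\<close>-null, so it
      contains a point satisfying both almost everywhere conditions.\<close>
    have "\<exists>y0. u y0 < G y0 \<and> (\<forall>y'. dist x y0 < dist x y' \<longrightarrow> u y' = 0) \<and>
            (ereal (dist x y0) = \<rho> \<longrightarrow> y0 = s)"
    proof (rule ccontr)
      assume n: "\<not> ?thesis"
      have "AE y in N. G y \<le> u y"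
        using below' s
      proof eventually_elim
        case (elim y)
        with n show ?case by (metis not_le)
      qed
      with nN show False ..
    qed
    then obtain y0 where y0: "u y0 < G y0" "\<And>y'. dist x y0 < dist x y' \<Longrightarrow> u y' = 0"
      "ereal (dist x y0) = \<rho> \<longrightarrow> y0 = s" by blast
    have "G y0 > 0" using y0(1) u(1)[of y0] by simp
    then have d0: "ereal (dist x y0) \<le> \<rho>"
      by (simp add: G_def cut_fun_def split: if_splits)
    from s show ?thesis
    proof eventually_elim
      case (elim y)
      consider "ereal (dist x y) < \<rho>" | "y = y0" | "dist x y0 < dist x y"
        using cut_trichotomy[OF d0 y0(3) elim] .
      then show ?case
      proof cases
        case 1 then show ?thesis using u(2)[of y] by (simp add: G_def cut_fun_def)
      next
        case 2 then show ?thesis using y0(1) h0(2)[of y] by simp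
      next
        case 3 then show ?thesis using y0(2) h0(2)[of y] G0(1)[of y] by simp
      qed
    qed
  qed
  with wh show ?thesis
  proof eventually_elim
    case (elim y)
    from elim have "cut_fun x \<rho> \<theta> w y = G y" by (simp add: G_def cut_fun_def)
    with elim show ?case by simp
  qed
qed

text \<open>Either some point within distance \<open>t\<close> witnesses that \<open>u\<close> has
  its full mass 1 within \<open>t\<close>, which is at least the total mass of \<open>F\<close>, or
  \<open>F \<le> u\<close> almost everywhere within \<open>t\<close>.\<close>

lemma nn_integral_ball_le:
  assumes "AE y in N. u y < F y \<longrightarrow>
      (\<integral>\<^sup>+ y. ennreal (u y) \<partial>N) = 1 \<and> (\<forall>y'. dist x y < dist x y' \<longrightarrow> u y' = 0)"
    and F: "(\<integral>\<^sup>+ y. ennreal (F y) \<partial>M) \<le> 1"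
  shows "(\<integral>\<^sup>+ y. ennreal (F y) * indicator {y. ereal (dist x y) \<le> t} y \<partial>M) \<le>
         (\<integral>\<^sup>+ y. ennreal (u y) * indicator {y. ereal (dist x y) \<le> t} y \<partial>N)"
proof (cases "\<exists>y0. ereal (dist x y0) \<le> t \<and> (\<integral>\<^sup>+ y. ennreal (u y) \<partial>N) = 1 \<and>
      (\<forall>y'. dist x y0 < dist x y' \<longrightarrow> u y' = 0)")
  case True
  then obtain y0 where y0: "ereal (dist x y0) \<le> t" "(\<integral>\<^sup>+ y. ennreal (u y) \<partial>N) = 1"
    "\<And>y'. dist x y0 < dist x y' \<Longrightarrow> u y' = 0" by blast
  have "ennreal (u y) * indicator {y. ereal (dist x y) \<le> t} y = ennreal (u y)" for y
  proof (cases "dist x y0 < dist x y")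
    case False
    then have "ereal (dist x y) \<le> ereal (dist x y0)" by simp
    with y0(1) have "ereal (dist x y) \<le> t" by order
    then show ?thesis by simp
  qed (simp add: y0(3))
  then have "(\<integral>\<^sup>+ y. ennreal (u y) * indicator {y. ereal (dist x y) \<le> t} y \<partial>N) = 1"
    using y0(2) by simp
  moreover have "(\<integral>\<^sup>+ y. ennreal (F y) * indicator {y. ereal (dist x y) \<le> t} y \<partial>M) \<le>
      (\<integral>\<^sup>+ y. ennreal (F y) \<partial>M)"
    by (rule nn_integral_mono) (simp add: indicator_def)
  ultimately show ?thesis using F by simp
next
  case False
  have "AE y in N. ereal (dist x y) \<le> t \<longrightarrow> F y \<le> u y"
    using assms(1)
  proof eventually_elim
    case (elim y)
    show ?case
    proof (rule impI, rule ccontr)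
      assume t: "ereal (dist x y) \<le> t" and "\<not> F y \<le> u y"
      with elim have "(\<integral>\<^sup>+ y. ennreal (u y) \<partial>N) = 1" "\<forall>y'. dist x y < dist x y' \<longrightarrow> u y' = 0"
        by (metis not_le)+
      with t False show False by blast
    qed
  qed
  then have "AE y in M. ereal (dist x y) \<le> t \<longrightarrow> F y \<le> u y"
    by (rule ae_M)
  then have "AE y in M. ennreal (F y) * indicator {y. ereal (dist x y) \<le> t} y \<le>
      ennreal (u y) * indicator {y. ereal (dist x y) \<le> t} y"
    by eventually_elim (auto simp: indicator_def ennreal_leI)
  then have "(\<integral>\<^sup>+ y. ennreal (F y) * indicator {y. ereal (dist x y) \<le> t} y \<partial>M) \<le>
      (\<integral>\<^sup>+ y. ennreal (u y) * indicator {y. ereal (dist x y) \<le> t} y \<partial>M)"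
    by (rule nn_integral_mono_AE)
  also have "\<dots> \<le> (\<integral>\<^sup>+ y. ennreal (u y) * indicator {y. ereal (dist x y) \<le> t} y \<partial>N)"
    by (rule nn_integral_M_le_N)
  finally show ?thesis .
qed

end

section \<open>The site-optimal construction\<close>

text \<open>\<open>An n\<close>, \<open>an n\<close>, \<open>rn n\<close> are shifted: they belong to stage \<open>n + 1\<close> of the construction, \<open>Rn n\<close> to stage \<open>n\<close>.\<close>

lemma site_optimalE:
  assumes "site_optimal \<phi> \<psi> A R a"
  obtains An Rn :: "nat \<Rightarrow> 'a::euclidean_space \<Rightarrow> 'a \<Rightarrow> real" and an rn \<theta> \<eta>
  where "\<And>x \<xi>. Rn 0 x \<xi> = 0"
    and "\<And>n x \<xi>. 0 \<le> Rn n x \<xi> \<and> Rn n x \<xi> \<le> 1"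
    and "\<And>n x \<xi>. 0 \<le> An n x \<xi> \<and> An n x \<xi> \<le> 1"
    and "\<And>n x. is_cut \<psi> x (\<lambda>\<xi>. 1 - Rn n x \<xi>) (an n x) (\<theta> n x) 0"
    and "\<And>n x \<xi>. An n x \<xi> = (if ereal (dist x \<xi>) \<le> an n x
           then Rn n x \<xi> + cut_fun x (an n x) (\<theta> n x) (\<lambda>\<xi>. 1 - Rn n x \<xi>) \<xi> else 0)"
    and "\<And>n \<xi>. is_cut \<phi> \<xi> (\<lambda>x. An n x \<xi>) (rn n \<xi>) (\<eta> n \<xi>) 1"
    and "\<And>n x \<xi>. Rn (Suc n) x \<xi> =
           An n x \<xi> - cut_fun \<xi> (rn n \<xi>) (\<eta> n \<xi>) (\<lambda>x. An n x \<xi>) x"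
    and "\<And>x \<xi>. (\<lambda>n. An n x \<xi>) \<longlonglongrightarrow> A x \<xi>"
    and "\<And>x \<xi>. (\<lambda>n. Rn n x \<xi>) \<longlonglongrightarrow> R x \<xi>"
    and "\<And>x. (\<lambda>n. an n x) \<longlonglongrightarrow> a x"
proof -
  from assms obtain An Rn an rn c c' where R0: "\<forall>x \<xi>. Rn 0 x \<xi> = (0::real)"
    and site: "\<forall>n x. an (Suc n) x = Sup (ereal ` {s::real.
            (\<integral>\<^sup>+ \<xi>. ennreal (1 - Rn n x \<xi>) * indicator (cball x s) \<xi> \<partial>\<psi>) \<le> 1}) \<and>
         0 \<le> c (Suc n) x \<and> c (Suc n) x \<le> 1 \<and>
         (\<forall>\<xi>. An (Suc n) x \<xi> =
            (if ereal (dist x \<xi>) < an (Suc n) x then 1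
             else if ereal (dist x \<xi>) = an (Suc n) x
               then c (Suc n) x * Rn n x \<xi> + 1 - c (Suc n) x
             else 0)) \<and>
         (an (Suc n) x < \<infinity> \<longrightarrow>
            (\<integral>\<^sup>+ \<xi>. ennreal (An (Suc n) x \<xi> - Rn n x \<xi>) \<partial>\<psi>) = 1) \<and>
         ((an (Suc n) x = \<infinity> \<or>
             emeasure \<psi> (sphere x (real_of_ereal (an (Suc n) x))) = 0)
            \<longrightarrow> c (Suc n) x = 1)"
    and center: "\<forall>n \<xi>. rn (Suc n) \<xi> = Sup (ereal ` {s::real.
            (\<integral>\<^sup>+ x. ennreal (An (Suc n) x \<xi>) * indicator (cball \<xi> s) x \<partial>\<phi>) \<le> 1}) \<and>
         0 \<le> c' (Suc n) \<xi> \<and> c' (Suc n) \<xi> \<le> 1 \<and>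
         (\<forall>x. Rn (Suc n) x \<xi> =
            (if ereal (dist x \<xi>) < rn (Suc n) \<xi> then 0
             else if ereal (dist x \<xi>) = rn (Suc n) \<xi>
               then c' (Suc n) \<xi> * An (Suc n) x \<xi>
             else An (Suc n) x \<xi>)) \<and>
         (rn (Suc n) \<xi> < \<infinity> \<longrightarrow>
            (\<integral>\<^sup>+ x. ennreal (An (Suc n) x \<xi> - Rn (Suc n) x \<xi>) \<partial>\<phi>) = 1) \<and>
         ((rn (Suc n) \<xi> = \<infinity> \<or>
             emeasure \<phi> (sphere \<xi> (real_of_ereal (rn (Suc n) \<xi>))) = 0)
            \<longrightarrow> c' (Suc n) \<xi> = 0)"
    and lim: "\<forall>x \<xi>. (\<lambda>n. An n x \<xi>) \<longlonglongrightarrow> A x \<xi>"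
      "\<forall>x \<xi>. (\<lambda>n. Rn n x \<xi>) \<longlonglongrightarrow> R x \<xi>" "\<forall>x. (\<lambda>n. an n x) \<longlonglongrightarrow> a x"
    unfolding site_optimal_def by (elim exE conjE) (rule that; assumption)
  note an = site[rule_format, THEN conjunct1]
    and site = site[rule_format, THEN conjunct2]
  note c = site[THEN conjunct1] site[THEN conjunct2, THEN conjunct1]
    and site = site[THEN conjunct2, THEN conjunct2]
  note An = site[THEN conjunct1, rule_format]
    and Aint = site[THEN conjunct2, THEN conjunct1, rule_format]
    and c1 = site[THEN conjunct2, THEN conjunct2, rule_format]
  note rn = center[rule_format, THEN conjunct1]
    and center = center[rule_format, THEN conjunct2]
  note c' = center[THEN conjunct1] center[THEN conjunct2, THEN conjunct1]
    and center = center[THEN conjunct2, THEN conjunct2]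
  note Rn = center[THEN conjunct1, rule_format]
    and Rint = center[THEN conjunct2, THEN conjunct1, rule_format]
    and c'0 = center[THEN conjunct2, THEN conjunct2, rule_format]
  note lim = lim[rule_format] and R0 = R0[rule_format]
  have An_bounds: "0 \<le> An (Suc n) x \<xi> \<and> An (Suc n) x \<xi> \<le> 1"
    if "0 \<le> Rn n x \<xi>" "Rn n x \<xi> \<le> 1" for n x \<xi>
  proof -
    have "0 \<le> c (Suc n) x * Rn n x \<xi> + (1 - c (Suc n) x)"
      using c[of n x] that by simp
    moreover have "c (Suc n) x * Rn n x \<xi> \<le> c (Suc n) x"
      using c[of n x] that by (simp add: mult_left_le)
    ultimately show ?thesis unfolding An by (simp add: algebra_simps)
  qed
  have Rn_bounds: "0 \<le> Rn n x \<xi> \<and> Rn n x \<xi> \<le> 1" for n x \<xi>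
  proof (induction n)
    case (Suc n)
    have "0 \<le> An (Suc n) x \<xi>" "An (Suc n) x \<xi> \<le> 1" using An_bounds Suc by blast+
    then show ?case unfolding Rn using c'[of n \<xi>] by (simp add: mult_le_one)
  qed (simp add: R0)
  \<comment> \<open>On the sphere \<open>c * R + 1 - c = R + (1 - c) * (1 - R)\<close>.\<close>
  have An_eq: "An (Suc n) x \<xi> = (if ereal (dist x \<xi>) \<le> an (Suc n) x
           then Rn n x \<xi> + cut_fun x (an (Suc n) x) (1 - c (Suc n) x) (\<lambda>\<xi>. 1 - Rn n x \<xi>) \<xi> else 0)"
    for n x \<xi>
    unfolding An cut_fun_def by (auto simp: algebra_simps)
  have Rn_eq: "Rn (Suc n) x \<xi> = An (Suc n) x \<xi> -
      cut_fun \<xi> (rn (Suc n) \<xi>) (1 - c' (Suc n) \<xi>) (\<lambda>x. An (Suc n) x \<xi>) x" for n x \<xi>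
    unfolding Rn cut_fun_def dist_commute[of \<xi> x] by (auto simp: algebra_simps)
  show ?thesis
  proof (rule that)
    show "Rn 0 x \<xi> = 0" for x \<xi> by (rule R0)
    show "0 \<le> Rn n x \<xi> \<and> Rn n x \<xi> \<le> 1" for n x \<xi> by (rule Rn_bounds)
    show "0 \<le> An (Suc n) x \<xi> \<and> An (Suc n) x \<xi> \<le> 1" for n x \<xi>
      using An_bounds Rn_bounds by blast
    show "is_cut \<psi> x (\<lambda>\<xi>. 1 - Rn n x \<xi>) (an (Suc n) x) (1 - c (Suc n) x) 0" for n x
      unfolding is_cut_def
    proof (intro conjI impI)
      show "an (Suc n) x = cut_radius \<psi> x (\<lambda>\<xi>. 1 - Rn n x \<xi>)"
        unfolding an cut_radius_def ..
      assume fin: "an (Suc n) x < \<infinity>"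
      \<comment> \<open>Outside the closed ball the difference is \<open>- Rn\<close>, which
        \<open>ennreal\<close> truncates to 0, the value of the cut there.\<close>
      have "ennreal (cut_fun x (an (Suc n) x) (1 - c (Suc n) x) (\<lambda>\<xi>. 1 - Rn n x \<xi>) \<xi>) =
          ennreal (An (Suc n) x \<xi> - Rn n x \<xi>)" for \<xi>
        using Rn_bounds[of n x \<xi>] by (auto simp: An_eq cut_fun_def ennreal_neg)
      with Aint[OF fin]
      show "(\<integral>\<^sup>+ y. ennreal (cut_fun x (an (Suc n) x) (1 - c (Suc n) x) (\<lambda>\<xi>. 1 - Rn n x \<xi>) y) \<partial>\<psi>) = 1"
        by simp
    qed (use c c1[of n x] in auto)
    show "An (Suc n) x \<xi> = (if ereal (dist x \<xi>) \<le> an (Suc n) x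
           then Rn n x \<xi> + cut_fun x (an (Suc n) x) (1 - c (Suc n) x) (\<lambda>\<xi>. 1 - Rn n x \<xi>) \<xi> else 0)"
      for n x \<xi> by (rule An_eq)
    show "is_cut \<phi> \<xi> (\<lambda>x. An (Suc n) x \<xi>) (rn (Suc n) \<xi>) (1 - c' (Suc n) \<xi>) 1" for n \<xi>
      unfolding is_cut_def
    proof (intro conjI impI)
      show "rn (Suc n) \<xi> = cut_radius \<phi> \<xi> (\<lambda>x. An (Suc n) x \<xi>)"
        unfolding rn cut_radius_def ..
      assume fin: "rn (Suc n) \<xi> < \<infinity>"
      show "(\<integral>\<^sup>+ y. ennreal (cut_fun \<xi> (rn (Suc n) \<xi>) (1 - c' (Suc n) \<xi>) (\<lambda>x. An (Suc n) x \<xi>) y) \<partial>\<phi>) = 1"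
        using Rint[OF fin] by (simp add: Rn_eq)
    qed (use c' c'0[of n \<xi>] in auto)
    show "Rn (Suc n) x \<xi> = An (Suc n) x \<xi> -
      cut_fun \<xi> (rn (Suc n) \<xi>) (1 - c' (Suc n) \<xi>) (\<lambda>x. An (Suc n) x \<xi>) x" for n x \<xi>
      by (rule Rn_eq)
    show "(\<lambda>n. An (Suc n) x \<xi>) \<longlonglongrightarrow> A x \<xi>" for x \<xi> by (rule LIMSEQ_Suc[OF lim(1)])
    show "(\<lambda>n. Rn n x \<xi>) \<longlonglongrightarrow> R x \<xi>" for x \<xi> by (rule lim(2))
    show "(\<lambda>n. an (Suc n) x) \<longlonglongrightarrow> a x" for x by (rule LIMSEQ_Suc[OF lim(3)])
  qed
qed

locale site_optimal_run = \<phi>: lf_borel \<phi> + \<psi>: lf_borel \<psi> + \<mu>: lf_borel \<mu>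
  for \<phi> \<psi> \<mu> :: "'a::euclidean_space measure" +
  fixes An Rn :: "nat \<Rightarrow> 'a \<Rightarrow> 'a \<Rightarrow> real" and an rn :: "nat \<Rightarrow> 'a \<Rightarrow> ereal" and \<theta> \<eta> :: "nat \<Rightarrow> 'a \<Rightarrow> real"
  assumes \<mu>_ge_\<phi>: "meas_ge \<mu> \<phi>"
    and sites_atomic: "AE x in \<mu>. atomic_spheres \<psi> x"
    and centers_atomic: "AE \<xi> in \<psi>. atomic_spheres \<mu> \<xi>"
    and Rn_0: "\<And>x \<xi>. Rn 0 x \<xi> = 0"
    and Rn_bounds: "\<And>n x \<xi>. 0 \<le> Rn n x \<xi> \<and> Rn n x \<xi> \<le> 1"
    and An_bounds: "\<And>n x \<xi>. 0 \<le> An n x \<xi> \<and> An n x \<xi> \<le> 1"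
    and site_cut: "\<And>n x. is_cut \<psi> x (\<lambda>\<xi>. 1 - Rn n x \<xi>) (an n x) (\<theta> n x) 0"
    and An_eq: "\<And>n x \<xi>. An n x \<xi> = (if ereal (dist x \<xi>) \<le> an n x
           then Rn n x \<xi> + cut_fun x (an n x) (\<theta> n x) (\<lambda>\<xi>. 1 - Rn n x \<xi>) \<xi> else 0)"
    and center_cut: "\<And>n \<xi>. is_cut \<phi> \<xi> (\<lambda>x. An n x \<xi>) (rn n \<xi>) (\<eta> n \<xi>) 1"
    and Rn_Suc: "\<And>n x \<xi>. Rn (Suc n) x \<xi> =
           An n x \<xi> - cut_fun \<xi> (rn n \<xi>) (\<eta> n \<xi>) (\<lambda>x. An n x \<xi>) x"
begin

sublocale sites: lf_triple \<mu> \<psi> \<psi>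
  by unfold_locales (simp add: meas_ge_def)

sublocale centers: lf_triple \<psi> \<mu> \<phi>
  by unfold_locales (rule \<mu>_ge_\<phi>)

section \<open>Measurability and monotonicity of the stages\<close>

lemma ae_borel_const: "ae_borel \<mu> \<psi> (\<lambda>x \<xi>. k)"
  unfolding ae_borel_def by (intro bexI[of _ "\<lambda>_. k"]) auto

lemma ae_borel_An_of_Rn:
  assumes "ae_borel \<mu> \<psi> (Rn n)"
  shows "ae_borel \<mu> \<psi> (An n)"
proof -
  have w: "ae_borel \<mu> \<psi> (\<lambda>x \<xi>. 1 - Rn n x \<xi>)"
    by (rule sites.ae_borel_diff[OF ae_borel_const assms])
  have b: "0 \<le> 1 - Rn n x \<xi> \<and> 1 - Rn n x \<xi> \<le> 1" for x \<xi>
    using Rn_bounds[of n x \<xi>] by simp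
  obtain \<rho> where [measurable]: "\<rho> \<in> borel_measurable borel" and \<rho>: "AE x in \<mu>. an n x = \<rho> x"
    using sites.cut_ae_borel(1)[OF w b sites_atomic site_cut] by blast
  obtain G where [measurable]: "G \<in> borel_measurable (borel \<Otimes>\<^sub>M borel)" and
    G: "AE z in \<mu> \<Otimes>\<^sub>M \<psi>. cut_fun (fst z) (an n (fst z)) (\<theta> n (fst z)) (\<lambda>\<xi>. 1 - Rn n (fst z) \<xi>) (snd z) = G z"
    using sites.cut_ae_borel(2)[OF w b sites_atomic site_cut] unfolding ae_borel_def by blast
  obtain R' where [measurable]: "R' \<in> borel_measurable (borel \<Otimes>\<^sub>M borel)" and
    R': "AE z in \<mu> \<Otimes>\<^sub>M \<psi>. Rn n (fst z) (snd z) = R' z"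
    using assms unfolding ae_borel_def by blast
  define A' where "A' z = (if ereal (dist (fst z) (snd z)) \<le> \<rho> (fst z) then R' z + G z else 0)" for z
  have "A' \<in> borel_measurable (borel \<Otimes>\<^sub>M borel)" unfolding A'_def by measurable
  moreover have "AE z in \<mu> \<Otimes>\<^sub>M \<psi>. An n (fst z) (snd z) = A' z"
    using sites.ae_fst[OF \<rho>] G R' by eventually_elim (simp add: An_eq A'_def)
  ultimately show ?thesis unfolding ae_borel_def by blast
qed

lemma ae_borel_Rn_Suc_of_An:
  assumes "ae_borel \<mu> \<psi> (An n)"
  shows "ae_borel \<mu> \<psi> (Rn (Suc n))"
proof -
  have A: "ae_borel \<psi> \<mu> (\<lambda>\<xi> x. An n x \<xi>)"
    by (rule sites.ae_borel_swap[OF assms])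
  have "ae_borel \<psi> \<mu> (\<lambda>\<xi>. cut_fun \<xi> (rn n \<xi>) (\<eta> n \<xi>) (\<lambda>x. An n x \<xi>))"
    by (rule centers.cut_ae_borel(2)[OF A An_bounds centers_atomic center_cut])
  from centers.ae_borel_swap[OF centers.ae_borel_diff[OF A this]]
  show ?thesis by (simp add: Rn_Suc[abs_def])
qed

lemma ae_borel_Rn: "ae_borel \<mu> \<psi> (Rn n)"
proof (induction n)
  case 0
  then show ?case using ae_borel_const[of 0] by (simp add: Rn_0[abs_def])
next
  case (Suc n)
  then show ?case by (intro ae_borel_Rn_Suc_of_An ae_borel_An_of_Rn)
qed

lemmas ae_borel_An = ae_borel_An_of_Rn[OF ae_borel_Rn]

lemma unit_borel_sites: "AE x in \<mu>. unit_borel \<psi> (\<lambda>\<xi>. 1 - Rn n x \<xi>)"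
  using Rn_bounds
  by (intro sites.ae_borel_section sites.ae_borel_diff ae_borel_const ae_borel_Rn) simp

lemma unit_borel_centers: "AE \<xi> in \<psi>. unit_borel \<mu> (\<lambda>x. An n x \<xi>)"
  using An_bounds
  by (intro centers.ae_borel_section sites.ae_borel_swap ae_borel_An) simp

text \<open>More rejection leaves a smaller weight \<open>1 - Rn\<close>, so the radius cannot
  shrink. If it grows, the old closed ball lies in the new open one, where the application is 1. If
  it stays the same and is finite, the fractions are compared on the sphere.\<close>

lemma An_mono_of_Rn_mono:
  assumes "AE z in \<mu> \<Otimes>\<^sub>M \<psi>. Rn n (fst z) (snd z) \<le> Rn (Suc n) (fst z) (snd z)"
  shows "AE z in \<mu> \<Otimes>\<^sub>M \<psi>. An n (fst z) (snd z) \<le> An (Suc n) (fst z) (snd z)"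
proof (rule sites.ae_lift_le[OF ae_borel_An ae_borel_An])
  show "AE x in \<mu>. AE \<xi> in \<psi>. An n x \<xi> \<le> An (Suc n) x \<xi>"
    using sites.AE_pair[OF assms] unit_borel_sites[of n] unit_borel_sites[of "Suc n"]
  proof eventually_elim
    case (elim x)
    have RR: "AE \<xi> in \<psi>. Rn n x \<xi> \<le> Rn (Suc n) x \<xi>" using elim(1) by simp
    then have ww: "AE \<xi> in \<psi>. 1 - Rn (Suc n) x \<xi> \<le> 1 - Rn n x \<xi>" by eventually_elim simp
    have an: "an n x \<le> an (Suc n) x"
      using cut_radius_mono[OF ww] site_cut by (simp add: is_cut_def)
    define tie where "tie \<longleftrightarrow> an n x = an (Suc n) x \<and> an n x < \<infinity>"
    have "\<theta> n x \<le> \<theta> (Suc n) x \<or> (AE \<xi> in \<psi>. ereal (dist x \<xi>) = an n x \<longrightarrow> 1 - Rn (Suc n) x \<xi> = 0)" if tie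
    proof -
      have "is_cut \<psi> x (\<lambda>\<xi>. 1 - Rn (Suc n) x \<xi>) (an n x) (\<theta> (Suc n) x) 0"
        using site_cut[of x "Suc n"] that by (simp add: tie_def)
      from \<psi>.cut_fraction_antimono[OF elim(3,2) ww this site_cut] that show ?thesis
        unfolding tie_def by blast
    qed
    then have "AE \<xi> in \<psi>. tie \<and> ereal (dist x \<xi>) = an n x \<longrightarrow> \<theta> n x \<le> \<theta> (Suc n) x \<or> Rn (Suc n) x \<xi> = 1"
      by (cases tie; cases "\<theta> n x \<le> \<theta> (Suc n) x") (auto elim: eventually_mono)
    then show ?case
      using RR
    proof eventually_elim
      case (elim \<xi>)
      consider "ereal (dist x \<xi>) > an n x" | "ereal (dist x \<xi>) < an (Suc n) x"
        | "ereal (dist x \<xi>) = an n x" "an n x = an (Suc n) x"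
        using an by fastforce
      then show ?case
      proof cases
        case 1
        then have "An n x \<xi> = 0" by (simp add: An_eq)
        then show ?thesis using An_bounds[of "Suc n" x \<xi>] by simp
      next
        case 2
        then have "An (Suc n) x \<xi> = 1" by (simp add: An_eq[of "Suc n"] cut_fun_def)
        then show ?thesis using An_bounds[of n x \<xi>] by simp
      next
        case 3
        then have "tie" unfolding tie_def by (metis less_ereal.simps(4))
        then have *: "\<theta> n x \<le> \<theta> (Suc n) x \<or> Rn (Suc n) x \<xi> = 1" using elim 3 by simp
        \<comment> \<open>On the common sphere \<open>1 - An = (1 - \<theta>) * (1 - Rn)\<close> at
          both stages.\<close>
        have "(1 - \<theta> (Suc n) x) * (1 - Rn (Suc n) x \<xi>) \<le> (1 - \<theta> n x) * (1 - Rn n x \<xi>)"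
          using *
        proof
          assume "\<theta> n x \<le> \<theta> (Suc n) x"
          then show ?thesis
            using elim(2) Rn_bounds[of "Suc n" x \<xi>] is_cut_fraction[OF site_cut[of x n]]
            by (intro mult_mono) auto
        next
          assume "Rn (Suc n) x \<xi> = 1"
          then show ?thesis
            using Rn_bounds[of n x \<xi>] is_cut_fraction[OF site_cut[of x n]] by simp
        qed
        then show ?thesis using 3 by (simp add: An_eq[of n] An_eq[of "Suc n"] cut_fun_def algebra_simps)
      qed
    qed
  qed
qed

text \<open>Larger applications fill a center within a smaller radius, so more is rejected. Unlike
  for sites, the cut integrates against \<open>\<phi>\<close>, whereas the conclusion must hold up
  to \<open>\<mu>\<close>-null sets.\<close>

lemma Rn_mono_of_An_mono:
  assumes "AE z in \<mu> \<Otimes>\<^sub>M \<psi>. An n (fst z) (snd z) \<le> An (Suc n) (fst z) (snd z)"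
  shows "AE z in \<mu> \<Otimes>\<^sub>M \<psi>. Rn (Suc n) (fst z) (snd z) \<le> Rn (Suc (Suc n)) (fst z) (snd z)"
proof -
  have "AE z in \<psi> \<Otimes>\<^sub>M \<mu>. Rn (Suc n) (snd z) (fst z) \<le> Rn (Suc (Suc n)) (snd z) (fst z)"
  proof (rule centers.ae_lift_le[OF sites.ae_borel_swap[OF ae_borel_Rn] sites.ae_borel_swap[OF ae_borel_Rn]])
    show "AE \<xi> in \<psi>. AE x in \<mu>. Rn (Suc n) x \<xi> \<le> Rn (Suc (Suc n)) x \<xi>"
      using centers.AE_pair[OF sites.ae_swap[OF assms]] unit_borel_centers[of n]
        unit_borel_centers[of "Suc n"] centers_atomic
    proof eventually_elim
      case (elim \<xi>)
      have ww: "AE x in \<mu>. An n x \<xi> \<le> An (Suc n) x \<xi>" using elim(1) by simp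
      have wwM: "AE x in \<phi>. An n x \<xi> \<le> An (Suc n) x \<xi>" by (rule centers.ae_M[OF ww])
      have u: "unit_borel \<phi> (\<lambda>x. An n x \<xi>)" "unit_borel \<phi> (\<lambda>x. An (Suc n) x \<xi>)"
        using elim(2,3) centers.ae_M unit_borel_mono_measure by blast+
      have rn: "rn (Suc n) \<xi> \<le> rn n \<xi>"
        using cut_radius_mono[OF wwM] center_cut by (simp add: is_cut_def)
      define tie where "tie \<longleftrightarrow> rn n \<xi> = rn (Suc n) \<xi> \<and> rn n \<xi> < \<infinity>"
      \<comment> \<open>On a \<open>\<phi>\<close>-null sphere the prescribed value makes both
        fractions 1. Otherwise the single \<open>\<mu>\<close>-atom turns vanishing
        \<open>\<phi>\<close>-a.e. into vanishing \<open>\<mu>\<close>-a.e.\<close>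
      have "\<eta> (Suc n) \<xi> \<le> \<eta> n \<xi> \<or> (AE x in \<mu>. ereal (dist \<xi> x) = rn n \<xi> \<longrightarrow> An n x \<xi> = 0)" if tie
      proof (cases "emeasure \<phi> (sphere \<xi> (real_of_ereal (rn n \<xi>))) = 0")
        case True
        then have "\<eta> n \<xi> = 1" "\<eta> (Suc n) \<xi> = 1"
          using center_cut[of \<xi> n] center_cut[of \<xi> "Suc n"] that unfolding is_cut_def tie_def by metis+
        then show ?thesis by simp
      next
        case False
        have "\<eta> (Suc n) \<xi> \<le> \<eta> n \<xi> \<or> (AE x in \<phi>. ereal (dist \<xi> x) = rn n \<xi> \<longrightarrow> An n x \<xi> = 0)"
        proof -
          have "is_cut \<phi> \<xi> (\<lambda>x. An (Suc n) x \<xi>) (rn n \<xi>) (\<eta> (Suc n) \<xi>) 1"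
            using center_cut[of \<xi> "Suc n"] that by (simp add: tie_def)
          from \<phi>.cut_fraction_antimono[OF u wwM center_cut this] that show ?thesis
            unfolding tie_def by blast
        qed
        moreover have "emeasure \<phi> {x. ereal (dist \<xi> x) = rn n \<xi>} \<noteq> 0"
        proof -
          have "{x. ereal (dist \<xi> x) = rn n \<xi>} = sphere \<xi> (real_of_ereal (rn n \<xi>))"
            using that by (intro sphere_eq_ereal is_cut_not_MInf[OF center_cut])
              (unfold tie_def, blast)
          with False show ?thesis by simp
        qed
        ultimately show ?thesis
          using centers.AE_zero_on_atomic_sphere[OF elim(4), of "rn n \<xi>" "\<lambda>x. An n x \<xi>"] by argo
      qed
      then have "AE x in \<mu>. tie \<and> ereal (dist \<xi> x) = rn n \<xi> \<longrightarrow> \<eta> (Suc n) \<xi> \<le> \<eta> n \<xi> \<or> An n x \<xi> = 0"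
        by (cases tie; cases "\<eta> (Suc n) \<xi> \<le> \<eta> n \<xi>") (auto elim: eventually_mono)
      then show ?case
        using ww
      proof eventually_elim
        case (elim x)
        have le: "Rn (Suc n) x \<xi> \<le> An n x \<xi>"
          using cut_fun_bounds(1)[of "\<eta> n \<xi>" "\<lambda>x. An n x \<xi>" x \<xi> "rn n \<xi>"] is_cut_fraction[OF center_cut[of \<xi> n]]
            An_bounds[of n x \<xi>] by (simp add: Rn_Suc)
        consider "ereal (dist \<xi> x) < rn n \<xi>" | "ereal (dist \<xi> x) > rn (Suc n) \<xi>"
          | "ereal (dist \<xi> x) = rn n \<xi>" "rn n \<xi> = rn (Suc n) \<xi>"
          using rn by fastforce
        then show ?case
        proof cases
          case 1
          then have "Rn (Suc n) x \<xi> = 0" by (simp add: Rn_Suc cut_fun_def)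
          then show ?thesis using Rn_bounds[of "Suc (Suc n)" x \<xi>] by simp
        next
          case 2
          then have "Rn (Suc (Suc n)) x \<xi> = An (Suc n) x \<xi>"
            by (auto simp: Rn_Suc[of "Suc n"] cut_fun_def)
          then show ?thesis using le elim(2) by simp
        next
          case 3
          then have "tie" unfolding tie_def by (metis less_ereal.simps(4))
          then have *: "\<eta> (Suc n) \<xi> \<le> \<eta> n \<xi> \<or> An n x \<xi> = 0" using elim 3 by simp
          have "(1 - \<eta> n \<xi>) * An n x \<xi> \<le> (1 - \<eta> (Suc n) \<xi>) * An (Suc n) x \<xi>"
            using *
          proof
            assume "\<eta> (Suc n) \<xi> \<le> \<eta> n \<xi>"
            then show ?thesis
              using elim(2) An_bounds[of n x \<xi>] is_cut_fraction[OF center_cut[of \<xi> "Suc n"]]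
              by (intro mult_mono) auto
          next
            assume "An n x \<xi> = 0"
            then show ?thesis
              using An_bounds[of "Suc n" x \<xi>] is_cut_fraction[OF center_cut[of \<xi> "Suc n"]] by simp
          qed
          then show ?thesis
            using 3 by (simp add: Rn_Suc[of n] Rn_Suc[of "Suc n"] cut_fun_def algebra_simps)
        qed
      qed
    qed
  qed
  from centers.ae_swap[OF this] show ?thesis .
qed

lemma Rn_mono: "AE z in \<mu> \<Otimes>\<^sub>M \<psi>. Rn n (fst z) (snd z) \<le> Rn (Suc n) (fst z) (snd z)"
proof (induction n)
  case 0
  then show ?case using Rn_bounds by (simp add: Rn_0)
next
  case (Suc n)
  then show ?case by (intro Rn_mono_of_An_mono An_mono_of_Rn_mono)
qed

end

section \<open>Comparison with a stable density\<close>

locale stable_comparison = site_optimal_run \<phi> \<psi> \<mu> An Rn an rn \<theta> \<eta> + \<nu>: lf_borel \<nu>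
  for \<phi> \<psi> \<mu> \<nu> :: "'a::euclidean_space measure" and An Rn an rn \<theta> \<eta> +
  fixes f A R :: "'a \<Rightarrow> 'a \<Rightarrow> real" and a :: "'a \<Rightarrow> ereal"
  assumes \<psi>_ge_\<nu>: "meas_ge \<psi> \<nu>"
    and density: "constrained_density \<mu> \<nu> f"
    and stable: "stable \<mu> \<nu> f"
    and An_lim: "\<And>x \<xi>. (\<lambda>n. An n x \<xi>) \<longlonglongrightarrow> A x \<xi>"
    and Rn_lim: "\<And>x \<xi>. (\<lambda>n. Rn n x \<xi>) \<longlonglongrightarrow> R x \<xi>"
    and an_lim: "\<And>x. (\<lambda>n. an n x) \<longlonglongrightarrow> a x"
begin

section \<open>Desires under the stable density and the bound on rejections\<close>

sublocale capacity: lf_dominated \<psi> \<nu>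
  by unfold_locales (rule \<psi>_ge_\<nu>)

lemma f_measurable: "(\<lambda>z. f (fst z) (snd z)) \<in> borel_measurable (borel \<Otimes>\<^sub>M borel)"
  using density by (simp add: constrained_density_def borel_prod case_prod_beta')

lemma f_measurable_compose [measurable (raw)]:
  assumes "g \<in> measurable M borel" "h \<in> measurable M borel"
  shows "(\<lambda>z. f (g z) (h z)) \<in> borel_measurable M"
proof -
  have "(\<lambda>z. (g z, h z)) \<in> measurable M (borel \<Otimes>\<^sub>M borel)"
    using assms by measurable
  from measurable_compose[OF this f_measurable] show ?thesis by simp
qed

lemma f_bounds: "0 \<le> f x \<xi>" "f x \<xi> \<le> 1"
  using density by (auto simp: constrained_density_def)

lemma f_mass: "site_mass f \<nu> x \<le> 1" "center_mass f \<mu> \<xi> \<le> 1"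
  using density by (auto simp: constrained_density_def)

lemma ae_borel_f: "ae_borel \<mu> \<psi> f"
  unfolding ae_borel_def using f_measurable by (intro bexI[of _ "\<lambda>z. f (fst z) (snd z)"]) auto

text \<open>Stands in for the existential clause of \<open>site_desires\<close>: nonzero mass
  implies that clause and is Borel in the pair, as lifting to the product requires.\<close>

definition far_mass :: "'a \<Rightarrow> 'a \<Rightarrow> ennreal" where
  "far_mass x \<xi> = (\<integral>\<^sup>+ \<xi>'. ennreal (f x \<xi>') * indicator {\<xi>'. dist x \<xi> < dist x \<xi>'} \<xi>' \<partial>\<nu>)"

lemma site_desiresI:
  assumes "f x \<xi> < 1" "site_mass f \<nu> x \<noteq> 1 \<or> far_mass x \<xi> \<noteq> 0"
  shows "site_desires \<nu> f x \<xi>"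
proof (rule ccontr)
  assume n: "\<not> ?thesis"
  then have m: "site_mass f \<nu> x = 1" and z: "\<And>\<xi>'. dist x \<xi> < dist x \<xi>' \<Longrightarrow> f x \<xi>' \<le> 0"
    using assms(1) unfolding site_desires_def by (meson not_less)+
  have "ennreal (f x \<xi>') * indicator {\<xi>'. dist x \<xi> < dist x \<xi>'} \<xi>' = 0" for \<xi>'
    using z[of \<xi>'] by (auto simp: indicator_def ennreal_neg)
  then have "far_mass x \<xi> = 0" unfolding far_mass_def by (simp only: nn_integral_const mult_zero_left)
  with m assms(2) show False by simp
qed

text \<open>An unexhausted site desires every center it does not fully possess. For an exhausted one
  the hypothesis gives \<open>f \<le> 1 - Rn\<close>, so falling short of the cut forces
  \<open>f\<close> to have mass farther out.\<close>

lemma AE_site_desires: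
  assumes "AE z in \<mu> \<Otimes>\<^sub>M \<psi>. f (fst z) (snd z) + Rn n (fst z) (snd z) \<le> 1"
  shows "AE z in \<mu> \<Otimes>\<^sub>M \<psi>. f (fst z) (snd z) < An n (fst z) (snd z) - Rn n (fst z) (snd z) \<longrightarrow>
           site_desires \<nu> f (fst z) (snd z)"
proof -
  let ?D = "\<lambda>x \<xi>. site_mass f \<nu> x \<noteq> 1 \<or> far_mass x \<xi> \<noteq> 0"
  have pointwise: "AE x in \<mu>. AE \<xi> in \<psi>. f x \<xi> < An n x \<xi> - Rn n x \<xi> \<longrightarrow> ?D x \<xi>"
    using sites.AE_pair[OF assms] unit_borel_sites[of n] sites_atomic
  proof eventually_elim
    case (elim x)
    show ?case
    proof (cases "site_mass f \<nu> x = 1")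
      case True
      have "AE \<xi> in \<psi>. f x \<xi> \<le> 1 - Rn n x \<xi>"
        using elim(1) by eventually_elim simp
      from capacity.AE_cut_le_or_farther_mass[OF elim(2) site_cut elim(3) _ f_bounds(1) this] True
      have "AE \<xi> in \<psi>. f x \<xi> < cut_fun x (an n x) (\<theta> n x) (\<lambda>\<xi>. 1 - Rn n x \<xi>) \<xi> \<longrightarrow> far_mass x \<xi> \<noteq> 0"
        unfolding site_mass_def far_mass_def by measurable
      then show ?thesis
      proof eventually_elim
        case (elim \<xi>)
        have "An n x \<xi> - Rn n x \<xi> \<le> cut_fun x (an n x) (\<theta> n x) (\<lambda>\<xi>. 1 - Rn n x \<xi>) \<xi>"
          using Rn_bounds[of n x \<xi>] by (auto simp: An_eq cut_fun_def)
        with elim show ?case by (metis order.strict_trans2)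
      qed
    qed simp
  qed
  obtain A' where [measurable]: "A' \<in> borel_measurable (borel \<Otimes>\<^sub>M borel)"
    and A': "AE z in \<mu> \<Otimes>\<^sub>M \<psi>. An n (fst z) (snd z) - Rn n (fst z) (snd z) = A' z"
    using sites.ae_borel_diff[OF ae_borel_An ae_borel_Rn] unfolding ae_borel_def by blast
  have "AE x in \<mu>. AE \<xi> in \<psi>. f x \<xi> < A' (x, \<xi>) \<longrightarrow> ?D x \<xi>"
    using pointwise sites.AE_pair[OF A']
  proof eventually_elim
    case (elim x)
    then show ?case by eventually_elim simp
  qed
  then have "AE z in \<mu> \<Otimes>\<^sub>M \<psi>. f (fst z) (snd z) < A' (fst z, snd z) \<longrightarrow> ?D (fst z) (snd z)"
    by (rule sites.ae_lift[rotated]) (unfold site_mass_def far_mass_def, measurable)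
  with A' show ?thesis
  proof eventually_elim
    case (elim z)
    show ?case
    proof
      assume l: "f (fst z) (snd z) < An n (fst z) (snd z) - Rn n (fst z) (snd z)"
      then have "f (fst z) (snd z) < 1"
        using An_bounds[of n "fst z" "snd z"] Rn_bounds[of n "fst z" "snd z"] by simp
      then show "site_desires \<nu> f (fst z) (snd z)"
        using l elim by (intro site_desiresI) auto
    qed
  qed
qed

text \<open>The only place where stability enters. It supplies the hypotheses on \<open>u\<close> in
  the two comparison lemmas used for centers.\<close>

lemma not_center_desires:
  assumes "site_desires \<nu> f x \<xi>"
  shows "(\<integral>\<^sup>+ x. ennreal (f x \<xi>) \<partial>\<mu>) = 1 \<and> (\<forall>y. dist \<xi> x < dist \<xi> y \<longrightarrow> f y \<xi> = 0)"
proof -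
  have "f x \<xi> < 1" "\<not> center_desires \<mu> f \<xi> x"
    using assms stable by (auto simp: stable_def site_desires_def)
  then have "center_mass f \<mu> \<xi> = 1" "\<And>y. dist x \<xi> < dist y \<xi> \<Longrightarrow> f y \<xi> \<le> 0"
    unfolding center_desires_def by (meson not_less)+
  then show ?thesis
    using f_bounds(1) by (auto simp: center_mass_def dist_commute intro: antisym)
qed

lemma AE_f_add_Rn_le_1: "AE z in \<mu> \<Otimes>\<^sub>M \<psi>. f (fst z) (snd z) + Rn n (fst z) (snd z) \<le> 1"
proof (induction n)
  case 0
  then show ?case using f_bounds by (simp add: Rn_0)
next
  case (Suc n)
  \<comment> \<open>The retained part \<open>An n - Rn (Suc n)\<close> is at most
    \<open>An n - Rn n\<close> by monotonicity, so falling short of the former already means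
    desire.\<close>
  have "AE z in \<mu> \<Otimes>\<^sub>M \<psi>. f (fst z) (snd z) < An n (fst z) (snd z) - Rn (Suc n) (fst z) (snd z) \<longrightarrow>
      site_desires \<nu> f (fst z) (snd z)"
    using AE_site_desires[OF Suc] Rn_mono[of n] by eventually_elim auto
  then have "AE z in \<psi> \<Otimes>\<^sub>M \<mu>. f (snd z) (fst z) < An n (snd z) (fst z) - Rn (Suc n) (snd z) (fst z) \<longrightarrow>
      site_desires \<nu> f (snd z) (fst z)"
    by (rule sites.ae_swap)
  from centers.AE_pair[OF this] unit_borel_centers[of n] centers_atomic
  have "AE \<xi> in \<psi>. AE x in \<mu>. f x \<xi> \<le> 1 - Rn (Suc n) x \<xi>"
  proof eventually_elim
    case (elim \<xi>)
    from elim(1) have "AE x in \<mu>. f x \<xi> < cut_fun \<xi> (rn n \<xi>) (\<eta> n \<xi>) (\<lambda>x. An n x \<xi>) x \<longrightarrow>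
        (\<forall>y. dist \<xi> x < dist \<xi> y \<longrightarrow> f y \<xi> = 0)"
      by eventually_elim (use not_center_desires in \<open>auto simp: Rn_Suc\<close>)
    moreover have "(\<integral>\<^sup>+ x. ennreal (f x \<xi>) \<partial>\<mu>) \<le> 1"
      using f_mass(2)[of \<xi>] by (simp add: center_mass_def)
    ultimately have "AE x in \<mu>. f x \<xi> + (An n x \<xi> - cut_fun \<xi> (rn n \<xi>) (\<eta> n \<xi>) (\<lambda>x. An n x \<xi>) x) \<le> 1"
      by (intro centers.AE_uncut_bound[OF elim(2) center_cut elim(3)] f_bounds) measurable
    then show ?case by eventually_elim (simp add: Rn_Suc)
  qed
  then have "AE z in \<psi> \<Otimes>\<^sub>M \<mu>. f (snd z) (fst z) \<le> 1 - Rn (Suc n) (snd z) (fst z)"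
    by (intro centers.ae_lift_le sites.ae_borel_swap sites.ae_borel_diff ae_borel_f ae_borel_const ae_borel_Rn)
  then have "AE z in \<mu> \<Otimes>\<^sub>M \<psi>. f (fst z) (snd z) \<le> 1 - Rn (Suc n) (fst z) (snd z)"
    by (rule centers.ae_swap)
  then show ?case by eventually_elim simp
qed

lemma AE_f_add_R_le_1: "AE z in \<mu> \<Otimes>\<^sub>M \<psi>. f (fst z) (snd z) + R (fst z) (snd z) \<le> 1"
proof -
  have "AE z in \<mu> \<Otimes>\<^sub>M \<psi>. \<forall>n. f (fst z) (snd z) + Rn n (fst z) (snd z) \<le> 1"
    using AE_f_add_Rn_le_1 by (simp add: AE_all_countable)
  then show ?thesis
  proof eventually_elim
    case (elim z)
    show ?case
      by (rule LIMSEQ_le_const2[OF tendsto_add[OF tendsto_const Rn_lim]]) (use elim in auto)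
  qed
qed

section \<open>Comparison of the limit densities\<close>

lemma A_eq_1: "ereal (dist x \<xi>) < a x \<Longrightarrow> A x \<xi> = 1"
proof -
  assume "ereal (dist x \<xi>) < a x"
  then have "\<forall>\<^sub>F n in sequentially. ereal (dist x \<xi>) < an n x"
    by (rule order_tendstoD(1)[OF an_lim])
  then have "\<forall>\<^sub>F n in sequentially. An n x \<xi> = 1"
    by eventually_elim (simp add: An_eq cut_fun_def)
  then have "(\<lambda>n. An n x \<xi>) \<longlonglongrightarrow> 1"
    by (rule tendsto_eventually)
  with An_lim show ?thesis by (rule LIMSEQ_unique)
qed

lemma A_eq_0: "a x < ereal (dist x \<xi>) \<Longrightarrow> A x \<xi> = 0"
proof -
  assume "a x < ereal (dist x \<xi>)"
  then have "\<forall>\<^sub>F n in sequentially. an n x < ereal (dist x \<xi>)"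
    by (rule order_tendstoD(2)[OF an_lim])
  then have "\<forall>\<^sub>F n in sequentially. An n x \<xi> = 0"
    by eventually_elim (simp add: An_eq)
  then have "(\<lambda>n. An n x \<xi>) \<longlonglongrightarrow> 0"
    by (rule tendsto_eventually)
  with An_lim show ?thesis by (rule LIMSEQ_unique)
qed

lemma R_nonneg: "0 \<le> R x \<xi>"
  by (rule LIMSEQ_le_const[OF Rn_lim]) (use Rn_bounds in auto)

text \<open>Below \<open>a x\<close> the limit density is \<open>1 - R\<close>, which dominates
  \<open>f\<close>. From a finite \<open>a x\<close> on, it has its whole mass, equal to 1, within
  \<open>t\<close>, and \<open>f\<close> has mass at most 1.\<close>

lemma AE_g_fun_le:
  "AE x in \<mu>. \<forall>t::ereal. 0 \<le> t \<longrightarrow> g_fun f x t \<nu> \<le> g_fun (\<lambda>x \<xi>. A x \<xi> - R x \<xi>) x t \<psi>"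
proof -
  have "AE x in \<mu>. \<forall>n. unit_borel \<psi> (\<lambda>\<xi>. 1 - Rn n x \<xi>)"
    using unit_borel_sites by (simp add: AE_all_countable)
  with sites.AE_pair[OF AE_f_add_R_le_1] show ?thesis
  proof (eventually_elim, intro allI impI)
    fix x and t :: ereal
    assume fR: "AE \<xi> in \<psi>. f (fst (x, \<xi>)) (snd (x, \<xi>)) + R (fst (x, \<xi>)) (snd (x, \<xi>)) \<le> 1"
      and w: "\<forall>n. unit_borel \<psi> (\<lambda>\<xi>. 1 - Rn n x \<xi>)" and t: "0 \<le> t"
    show "g_fun f x t \<nu> \<le> g_fun (\<lambda>x \<xi>. A x \<xi> - R x \<xi>) x t \<psi>"
    proof (cases "t < a x \<or> a x = \<infinity>")
      case True
      \<comment> \<open>If \<open>a x = \<infinity>\<close>, this includes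
        \<open>t = \<infinity>\<close>, since distances are finite.\<close>
      have A1: "A x \<xi> = 1" if "ereal (dist x \<xi>) \<le> t" for \<xi>
        by (rule A_eq_1) (use True that in \<open>auto intro: le_less_trans\<close>)
      have "g_fun f x t \<nu> \<le> g_fun f x t \<psi>"
        unfolding g_fun_def by (rule capacity.nn_integral_M_le_N)
      also have "\<dots> \<le> g_fun (\<lambda>x \<xi>. A x \<xi> - R x \<xi>) x t \<psi>"
        unfolding g_fun_def
      proof (rule nn_integral_mono_AE)
        show "AE \<xi> in \<psi>. ennreal (f x \<xi>) * indicator {\<xi>. ereal (dist x \<xi>) \<le> t} \<xi> \<le>
            ennreal (A x \<xi> - R x \<xi>) * indicator {\<xi>. ereal (dist x \<xi>) \<le> t} \<xi>"
          using fR by eventually_elim (auto simp: indicator_def A1 intro: ennreal_leI)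
      qed
      finally show ?thesis .
    next
      case False
      then have at: "a x \<le> t" and fin: "a x < \<infinity>" by auto
      \<comment> \<open>Any real bound above \<open>a x\<close> eventually bounds all
        \<open>an n x\<close>, giving one ball for dominated convergence.\<close>
      obtain b where b: "a x < ereal b"
        using fin by (cases "a x") (auto intro: that[of "real_of_ereal (a x) + 1"])
      have ev: "\<forall>\<^sub>F n in sequentially. an n x < ereal b"
        by (rule order_tendstoD(2)[OF an_lim b])
      define u where "u n = cut_fun x (an n x) (\<theta> n x) (\<lambda>\<xi>. 1 - Rn n x \<xi>)" for n
      have u_eq: "ennreal (u n \<xi>) = ennreal (An n x \<xi> - Rn n x \<xi>)" for n \<xi>
        using Rn_bounds[of n x \<xi>] by (auto simp: u_def An_eq cut_fun_def ennreal_neg)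
      have 1: "(\<integral>\<^sup>+ \<xi>. ennreal (A x \<xi> - R x \<xi>) \<partial>\<psi>) = 1"
      proof (rule \<psi>.nn_integral_lim_eq_1[of u x b])
        show "unit_borel \<psi> (u n)" for n
          unfolding u_def using w is_cut_fraction[OF site_cut] by (intro unit_borel_cut_fun) auto
        show "\<forall>\<^sub>F n in sequentially. (\<integral>\<^sup>+ y. ennreal (u n y) \<partial>\<psi>) = 1"
          using ev
        proof eventually_elim
          case (elim n)
          then have "an n x < \<infinity>" by auto
          then show ?case using site_cut[of x n] unfolding u_def is_cut_def by blast
        qed
        show "\<forall>\<^sub>F n in sequentially. \<forall>y. y \<notin> cball x b \<longrightarrow> u n y = 0"
          using ev
        proof eventually_elim
          case (elim n)
          have "\<not> ereal (dist x y) < an n x \<and> ereal (dist x y) \<noteq> an n x" if "y \<notin> cball x b" for y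
          proof -
            have "ereal b < ereal (dist x y)" using that by simp
            with elim have "an n x < ereal (dist x y)" by order
            then show ?thesis by auto
          qed
          then show ?case by (simp add: u_def cut_fun_def)
        qed
        show "(\<lambda>n. ennreal (u n y)) \<longlonglongrightarrow> ennreal (A x y - R x y)" for y
          unfolding u_eq by (intro tendsto_ennrealI tendsto_diff An_lim Rn_lim)
      qed
      have "ennreal (A x \<xi> - R x \<xi>) * indicator {\<xi>. ereal (dist x \<xi>) \<le> t} \<xi> = ennreal (A x \<xi> - R x \<xi>)" for \<xi>
      proof (cases "ereal (dist x \<xi>) \<le> t")
        case False
        then have "A x \<xi> = 0" using at by (intro A_eq_0) order
        then show ?thesis using R_nonneg[of x \<xi>] by (simp add: ennreal_neg)
      qed simp
      then have "g_fun (\<lambda>x \<xi>. A x \<xi> - R x \<xi>) x t \<psi> = 1"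
        unfolding g_fun_def using 1 by simp
      moreover have "g_fun f x t \<nu> \<le> site_mass f \<nu> x"
        unfolding g_fun_def site_mass_def by (rule nn_integral_mono) (simp add: indicator_def)
      ultimately show ?thesis using f_mass(1)[of x] by simp
    qed
  qed
qed

text \<open>If \<open>f < A - R\<close> at a pair, then \<open>f < An n - Rn n\<close> already at
  some stage, so the site desires the center. Stability then confines the full mass of
  \<open>f\<close> at the center to sites no farther away.\<close>

lemma AE_h_fun_le:
  "AE \<xi> in \<psi>. \<forall>t::ereal. 0 \<le> t \<longrightarrow> h_fun (\<lambda>x \<xi>. A x \<xi> - R x \<xi>) \<xi> t \<phi> \<le> h_fun f \<xi> t \<mu>"
proof -
  have "AE z in \<mu> \<Otimes>\<^sub>M \<psi>. \<forall>n. f (fst z) (snd z) < An n (fst z) (snd z) - Rn n (fst z) (snd z) \<longrightarrow>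
      site_desires \<nu> f (fst z) (snd z)"
    unfolding AE_all_countable by (intro allI AE_site_desires AE_f_add_Rn_le_1)
  then have "AE z in \<mu> \<Otimes>\<^sub>M \<psi>. f (fst z) (snd z) < A (fst z) (snd z) - R (fst z) (snd z) \<longrightarrow>
      site_desires \<nu> f (fst z) (snd z)"
  proof eventually_elim
    case (elim z)
    show ?case
    proof
      assume "f (fst z) (snd z) < A (fst z) (snd z) - R (fst z) (snd z)"
      from order_tendstoD(1)[OF tendsto_diff[OF An_lim Rn_lim] this]
      have "\<exists>n. f (fst z) (snd z) < An n (fst z) (snd z) - Rn n (fst z) (snd z)"
        by (auto simp: eventually_sequentially)
      with elim show "site_desires \<nu> f (fst z) (snd z)" by blast
    qed
  qed
  then have desires: "AE z in \<psi> \<Otimes>\<^sub>M \<mu>. f (snd z) (fst z) < A (snd z) (fst z) - R (snd z) (fst z) \<longrightarrow>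
      site_desires \<nu> f (snd z) (fst z)"
    by (rule sites.ae_swap)
  have "AE \<xi> in \<psi>. \<forall>n. unit_borel \<mu> (\<lambda>x. An n x \<xi>)"
    using unit_borel_centers by (simp add: AE_all_countable)
  with centers.AE_pair[OF desires] show ?thesis
  proof eventually_elim
    case (elim \<xi>)
    have w: "unit_borel \<phi> (\<lambda>x. An n x \<xi>)" for n
      using elim(2) centers.ae_M unit_borel_mono_measure by blast
    define u where "u n = cut_fun \<xi> (rn n \<xi>) (\<eta> n \<xi>) (\<lambda>x. An n x \<xi>)" for n
    have u_eq: "u n x = An n x \<xi> - Rn (Suc n) x \<xi>" for n x
      by (simp add: u_def Rn_Suc)
    \<comment> \<open>Only an upper bound is needed, so Fatou's lemma suffices even when radii
      \<open>rn\<close> are infinite. The index shift in \<open>Rn (Suc n)\<close> does not change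
      the limit.\<close>
    have mass: "(\<integral>\<^sup>+ x. ennreal (A x \<xi> - R x \<xi>) \<partial>\<phi>) \<le> 1"
    proof (rule \<phi>.nn_integral_lim_le_1[of u])
      show "unit_borel \<phi> (u n)" for n
        unfolding u_def using w is_cut_fraction[OF center_cut] by (intro unit_borel_cut_fun) auto
      show "(\<integral>\<^sup>+ y. ennreal (u n y) \<partial>\<phi>) \<le> 1" for n
        unfolding u_def by (rule \<phi>.nn_integral_cut_le_1[OF w center_cut])
      show "(\<lambda>n. ennreal (u n x)) \<longlonglongrightarrow> ennreal (A x \<xi> - R x \<xi>)" for x
        unfolding u_eq by (intro tendsto_ennrealI tendsto_diff An_lim LIMSEQ_Suc Rn_lim)
    qed
    have "AE x in \<mu>. f x \<xi> < A x \<xi> - R x \<xi> \<longrightarrow>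
        (\<integral>\<^sup>+ x. ennreal (f x \<xi>) \<partial>\<mu>) = 1 \<and> (\<forall>y. dist \<xi> x < dist \<xi> y \<longrightarrow> f y \<xi> = 0)"
      using elim(1) by eventually_elim (use not_center_desires in auto)
    from centers.nn_integral_ball_le[OF this mass] show ?case
      by (simp add: h_fun_def dist_commute)
  qed
qed

end

theorem mainTheorem10:
  fixes \<phi> \<psi> \<mu> \<nu> :: "'a::euclidean_space measure"
    and f A R :: "'a \<Rightarrow> 'a \<Rightarrow> real" and a :: "'a \<Rightarrow> ereal"
  assumes "borel_meas \<phi>" "borel_meas \<psi>" "borel_meas \<mu>" "borel_meas \<nu>"
    and "locally_finite \<phi>" "locally_finite \<psi>" "locally_finite \<mu>" "locally_finite \<nu>"
    and "meas_ge \<mu> \<phi>" and "meas_ge \<psi> \<nu>"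
    and "assumption1 \<mu> \<psi>"
    and "constrained_density \<mu> \<nu> f" and "stable \<mu> \<nu> f"
    and "site_optimal \<phi> \<psi> A R a"
  shows "(AE z in \<mu> \<Otimes>\<^sub>M \<psi>. f (fst z) (snd z) + R (fst z) (snd z) \<le> 1)
    \<and> (AE z in \<mu> \<Otimes>\<^sub>M \<psi>.
         (A (fst z) (snd z) = 1 \<or> ereal (dist (fst z) (snd z)) < a (fst z))
           \<longrightarrow> f (fst z) (snd z) \<le> A (fst z) (snd z) - R (fst z) (snd z))
    \<and> (AE x in \<mu>. \<forall>t::ereal. 0 \<le> t \<longrightarrow>
         g_fun f x t \<nu> \<le> g_fun (\<lambda>x \<xi>. A x \<xi> - R x \<xi>) x t \<psi>)
    \<and> (AE \<xi> in \<psi>. \<forall>t::ereal. 0 \<le> t \<longrightarrow>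
         h_fun (\<lambda>x \<xi>. A x \<xi> - R x \<xi>) \<xi> t \<phi> \<le> h_fun f \<xi> t \<mu>)"
proof -
  obtain An Rn an rn \<theta> \<eta> where run:
    "\<And>x \<xi>. Rn 0 x \<xi> = 0"
    "\<And>n x \<xi>. 0 \<le> Rn n x \<xi> \<and> Rn n x \<xi> \<le> 1"
    "\<And>n x \<xi>. 0 \<le> An n x \<xi> \<and> An n x \<xi> \<le> 1"
    "\<And>n x. is_cut \<psi> x (\<lambda>\<xi>. 1 - Rn n x \<xi>) (an n x) (\<theta> n x) 0"
    "\<And>n x \<xi>. An n x \<xi> = (if ereal (dist x \<xi>) \<le> an n x
       then Rn n x \<xi> + cut_fun x (an n x) (\<theta> n x) (\<lambda>\<xi>. 1 - Rn n x \<xi>) \<xi> else 0)"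
    "\<And>n \<xi>. is_cut \<phi> \<xi> (\<lambda>x. An n x \<xi>) (rn n \<xi>) (\<eta> n \<xi>) 1"
    "\<And>n x \<xi>. Rn (Suc n) x \<xi> =
       An n x \<xi> - cut_fun \<xi> (rn n \<xi>) (\<eta> n \<xi>) (\<lambda>x. An n x \<xi>) x"
    "\<And>x \<xi>. (\<lambda>n. An n x \<xi>) \<longlonglongrightarrow> A x \<xi>"
    "\<And>x \<xi>. (\<lambda>n. Rn n x \<xi>) \<longlonglongrightarrow> R x \<xi>"
    "\<And>x. (\<lambda>n. an n x) \<longlonglongrightarrow> a x"
    by (rule site_optimalE[OF assms(14)]) (rule that)
  interpret stable_comparison \<phi> \<psi> \<mu> \<nu> An Rn an rn \<theta> \<eta> f A R a
  proof
    show "AE x in \<mu>. atomic_spheres \<psi> x" "AE \<xi> in \<psi>. atomic_spheres \<mu> \<xi>"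
      using assms(11) by (simp_all add: assumption1_def atomic_spheres_def)
  qed (fact assms run)+
  \<comment> \<open>Where \<open>A = 1\<close>, the bound \<open>f + R \<le> 1\<close> is the
    claim.\<close>
  have "AE z in \<mu> \<Otimes>\<^sub>M \<psi>. (A (fst z) (snd z) = 1 \<or> ereal (dist (fst z) (snd z)) < a (fst z))
      \<longrightarrow> f (fst z) (snd z) \<le> A (fst z) (snd z) - R (fst z) (snd z)"
    using AE_f_add_R_le_1 by eventually_elim (use A_eq_1 in auto)
  with AE_f_add_R_le_1 AE_g_fun_le AE_h_fun_le show ?thesis by blast
qed

end
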